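(* Let $\mu,\nu>0$ with $\mu+\nu=1$. For each integer $N\ge1$ let $C_N$ be an integer with $1\le C_N\le N$, and let $(X_N(t))_{t\ge0}$ be the Engset process with $N$ sources, capacity $C_N$ and parameters $\nu,\mu$, started at $X_N(0)=C_N$. Let $T_0^{X_N}=\inf\{s\ge0:X_N(s)=0\}$. If $C_N=\nu N+o(\sqrt{N})$ as $N\to+\infty$, then the sequence of random variables $$\left(N(1-\nu)^N\,T_0^{X_N}\right)$$ converges in distribution, as $N\to+\infty$, to an exponential random variable with parameter $2\nu$.
   Context: The Engset process $(X_N(t))_{t\ge0}$ with $N$ sources, capacity $C_N$ ($1\le C_N\le N$) and parameters $\nu,\mu>0$ is the continuous-time (right-continuous) birth and death Markov process on $\{0,1,\ldots,C_N\}$ with transition rates $q(x,x-1)=\mu x$ for $0\le x\le C_N$ and $q(x,x+1)=\nu(N-x)$ for $0\le x<C_N$ (no upward jump from $C_N$). The time scale is normalized so that $\mu+\nu=1$. An exponential random variable with parameter $\lambda$ has mean $1/\lambda$. *)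

theory Defs
  imports "HOL-Probability.Probability" "HOL-Library.Landau_Symbols"
begin

definition transition_function :: "'s set \<Rightarrow> (real \<Rightarrow> 's \<Rightarrow> 's \<Rightarrow> real) \<Rightarrow> bool" where
  "transition_function S p \<longleftrightarrow>
     (\<forall>t\<ge>0. \<forall>x\<in>S. \<forall>y\<in>S. 0 \<le> p t x y) \<and>
     (\<forall>t\<ge>0. \<forall>x\<in>S. (\<Sum>y\<in>S. p t x y) = 1) \<and>
     (\<forall>x\<in>S. \<forall>y\<in>S. p 0 x y = (if x = y then 1 else 0)) \<and>
     (\<forall>s\<ge>0. \<forall>t\<ge>0. \<forall>x\<in>S. \<forall>y\<in>S. p (s + t) x y = (\<Sum>z\<in>S. p s x z * p t z y))"

text \<open>On a finite state space the rates between distinct states determine the transition function;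
  the diagonal values of \<open>q\<close> are irrelevant.\<close>

definition has_transition_rates ::
    "'s set \<Rightarrow> (real \<Rightarrow> 's \<Rightarrow> 's \<Rightarrow> real) \<Rightarrow> ('s \<Rightarrow> 's \<Rightarrow> real) \<Rightarrow> bool" where
  "has_transition_rates S p q \<longleftrightarrow>
     (\<forall>x\<in>S. \<forall>y\<in>S. x \<noteq> y \<longrightarrow> ((\<lambda>h. p h x y / h) \<longlongrightarrow> q x y) (at_right 0))"

definition markov_property ::
    "'a measure \<Rightarrow> 's set \<Rightarrow> (real \<Rightarrow> 's \<Rightarrow> 's \<Rightarrow> real) \<Rightarrow> (real \<Rightarrow> 'a \<Rightarrow> 's) \<Rightarrow> bool" where
  "markov_property M S p X \<longleftrightarrow>
     (\<forall>(n::nat) (t::nat \<Rightarrow> real) (x::nat \<Rightarrow> 's) (s::real) (y::'s).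
        0 \<le> t 0 \<and> (\<forall>i<n. t i < t (Suc i)) \<and> 0 \<le> s \<and> y \<in> S \<and>
        \<P>(\<omega> in M. \<forall>i\<le>n. X (t i) \<omega> = x i) \<noteq> 0 \<longrightarrow>
        \<P>(\<omega> in M. X (t n + s) \<omega> = y \<bar> \<forall>i\<le>n. X (t i) \<omega> = x i) = p s (x n) y)"

text \<open>A right-continuous, time-homogeneous Markov process \<open>(X t)\<close>, \<open>t \<ge> 0\<close>, on the finite state
  space \<open>S\<close> with transition rates \<open>q\<close>; its initial distribution is left open. Values of \<open>X\<close> at
  negative times are unconstrained and never used.\<close>

definition finite_markov_process ::
    "'a measure \<Rightarrow> 's::discrete_topology set \<Rightarrow> ('s \<Rightarrow> 's \<Rightarrow> real) \<Rightarrow> (real \<Rightarrow> 'a \<Rightarrow> 's) \<Rightarrow> bool" where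
  "finite_markov_process M S q X \<longleftrightarrow>
     prob_space M \<and> finite S \<and>
     (\<forall>t\<ge>0. X t \<in> M \<rightarrow>\<^sub>M count_space S) \<and>
     (\<forall>\<omega>\<in>space M. \<forall>t\<ge>0. continuous (at_right t) (\<lambda>s. X s \<omega>)) \<and>
     (\<exists>p. transition_function S p \<and> has_transition_rates S p q \<and> markov_property M S p X)"

definition engset_rate :: "nat \<Rightarrow> nat \<Rightarrow> real \<Rightarrow> real \<Rightarrow> nat \<Rightarrow> nat \<Rightarrow> real" where
  "engset_rate N C \<nu> \<mu> x y =
     (if x = Suc y then \<mu> * real x
      else if y = Suc x \<and> x < C then \<nu> * (real N - real x)
      else 0)"

definition engset_process ::
    "'a measure \<Rightarrow> nat \<Rightarrow> nat \<Rightarrow> real \<Rightarrow> real \<Rightarrow> (real \<Rightarrow> 'a \<Rightarrow> nat) \<Rightarrow> bool" where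
  "engset_process M N C \<nu> \<mu> X \<longleftrightarrow> finite_markov_process M {0..C} (engset_rate N C \<nu> \<mu>) X"

text \<open>Extended-real valued, so that the hitting time is \<open>\<infinity>\<close> on paths that never visit \<open>a\<close>.\<close>

definition hitting_time :: "(real \<Rightarrow> 'a \<Rightarrow> 's) \<Rightarrow> 's \<Rightarrow> 'a \<Rightarrow> ereal" where
  "hitting_time X a \<omega> = Inf {ereal s | s. 0 \<le> s \<and> X s \<omega> = a}"

end

theory Submission
  imports Defs "HOL-Real_Asymp.Real_Asymp"
begin

text \<open>Let \<open>h x\<close> be the mean time to reach \<open>0\<close> from \<open>x\<close>, the solution of \<open>L h = - 1\<close>, \<open>h 0 = 0\<close>
  for the generator \<open>L\<close>. Since \<open>h 1 \<le> h x \<le> h C\<close> for \<open>x \<noteq> 0\<close>, the function \<open>h / h 1\<close> satisfies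
  \<open>L f \<le> - f / h C\<close> and \<open>f \<ge> 1\<close>, while \<open>h / h C\<close> satisfies \<open>L f \<ge> - f / h 1\<close> and \<open>f \<le> 1\<close>; comparing
  the survival probability with \<open>exp (- k t) f\<close> gives
  \<open>exp (- t / h 1) \<le> P(T > t) \<le> h C / h 1 * exp (- t / h C)\<close>. Explicitly
  \<open>N (1 - \<nu>) ^ N h 1 = P(1 \<le> Bin(N, \<nu>) \<le> C) / \<nu>\<close>, which tends to \<open>1 / (2 \<nu>)\<close> by the de Moivre-Laplace
  theorem, and \<open>h C / h 1\<close> tends to \<open>1\<close>, because the return to \<open>1\<close> from the bulk takes negligible time.\<close>

section \<open>Hitting times of finite Markov processes\<close>

text \<open>The process is known only through conditional probabilities at finitely many times and
  right continuity, so the comparison with \<open>exp (- k t) f\<close> is made on grids of mesh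
  \<open>t / n\<close>. One step of the chain killed at \<open>0\<close> multiplies \<open>f\<close>
  by at most \<open>1 - t / n * (k - e)\<close>, or at least \<open>1 - t / n * (k + e)\<close>; the
  slack \<open>e\<close> absorbs the \<open>o(h)\<close> hidden in the rates, and n-th powers tend
  to exponentials. The two directions differ: survival implies avoidance on every grid, but
  avoidance on one grid says nothing about the times in between, so the lower bound intersects
  nested dyadic grids and uses right continuity. Both inequalities for \<open>f\<close> come from
  the constancy of \<open>L (h / c) = - 1 / c\<close>, where the constant 1 is compared with
  \<open>h x / h C\<close> or \<open>h x / h 1\<close>. Starting at \<open>C\<close> makes
  \<open>f = 1\<close> in the lower bound and leaves only the prefactor \<open>h C / h 1\<close> in
  the upper one. That this ratio tends to 1 needs no more than \<open>C / N\<close> tending to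
  \<nu>; the finer condition \<open>o(sqrt N)\<close> places \<open>C\<close> asymptotically at the
  median of the binomial law, which produces the factor 2 in the limit parameter.\<close>

lemma hitting_time_less_iff:
  "hitting_time X a \<omega> < c \<longleftrightarrow> (\<exists>s\<ge>0. ereal s < c \<and> X s \<omega> = a)"
  by (auto simp: hitting_time_def Inf_less_iff)

lemma hitting_time_nonneg: "0 \<le> hitting_time X a \<omega>"
  unfolding hitting_time_def by (rule Inf_greatest) auto

lemma filterlim_grid_step:
  assumes "0 < t"
  shows "filterlim (\<lambda>n. t / real n) (at_right 0) sequentially"
proof -
  have "(\<lambda>n. t / real n) \<longlonglongrightarrow> 0" by real_asymp
  moreover have "\<forall>\<^sub>F n in sequentially. t / real n \<in> {0<..} \<and> t / real n \<noteq> 0"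
    using eventually_gt_at_top[of "0::nat"] by eventually_elim (use assms in simp)
  ultimately show ?thesis unfolding filterlim_at by simp
qed

text \<open>Iterating a one-step inequality multiplies it by this factor, which preserves the
  inequality only if the factor is nonnegative. Since \<open>k\<close> may have either sign and any
  size, this holds for large \<open>n\<close> only.\<close>

lemma grid_factor_nonneg:
  fixes t k :: real
  shows "\<forall>\<^sub>F n in sequentially. 0 \<le> 1 - t / real n * k"
proof -
  have "(\<lambda>n. 1 - t / real n * k) \<longlonglongrightarrow> 1" by real_asymp
  then have "\<forall>\<^sub>F n in sequentially. 0 < 1 - t / real n * k"
    by (rule order_tendstoD) simp
  then show ?thesis by (rule eventually_mono) simp
qed

lemma grid_factor_limit:
  fixes t k :: real
  shows "(\<lambda>n. c * (1 - t / real n * k) ^ n) \<longlonglongrightarrow> c * exp (- k * t)"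
  using tendsto_mult[OF tendsto_const tendsto_exp_limit_sequentially[of "- k * t"], of c]
  by (simp add: mult.commute)

text \<open>This lets a dyadic grid detect a path that rests in a state during a short interval
  after \<open>s\<close>. Choose \<open>m\<close> so that the mesh is below \<open>u - s\<close> and
  round \<open>s\<close> up to the grid; the bound on \<open>i\<close> follows from
  \<open>u \<le> t\<close>.\<close>

lemma dyadic_between:
  fixes s u t :: real
  assumes "0 < t" "0 \<le> s" "s < u" "u \<le> t"
  obtains m i :: nat where "i \<le> 2 ^ m" "s \<le> real i * (t / real (2 ^ m))" "real i * (t / real (2 ^ m)) < u"
proof -
  obtain m where m: "t / (u - s) < 2 ^ m"
    using real_arch_pow[of 2 "t / (u - s)"] by auto
  define i where "i = nat \<lceil>s * 2 ^ m / t\<rceil>"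
  have ri: "real i = of_int \<lceil>s * 2 ^ m / t\<rceil>" using assms by (simp add: i_def)
  have "s * 2 ^ m / t \<le> real i" "real i < s * 2 ^ m / t + 1" unfolding ri by linarith+
  then have 1: "s \<le> real i * (t / 2 ^ m)" and 2: "real i * (t / 2 ^ m) < s + t / 2 ^ m"
    using assms by (auto simp: field_simps)
  have "t / 2 ^ m < u - s" using m assms by (simp add: field_simps)
  then have 3: "real i * (t / 2 ^ m) < u" using 2 by simp
  then have "real i * (t / 2 ^ m) < t" using assms by simp
  then have "real i < 2 ^ m" using assms by (simp add: field_simps)
  then have "i \<le> 2 ^ m" by (metis of_nat_less_iff of_nat_numeral of_nat_power order_less_imp_le)
  with 1 3 show ?thesis by (intro that[of i m]) auto
qed

text \<open>The transition function is existentially quantified in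
  \<open>finite_markov_process\<close>; as a parameter it can be named in statements about the
  sampled chain.\<close>

locale finite_markov_chain = prob_space M
  for M :: "'a measure" +
  fixes S :: "'s::discrete_topology set"
    and q :: "'s \<Rightarrow> 's \<Rightarrow> real"
    and X :: "real \<Rightarrow> 'a \<Rightarrow> 's"
    and p :: "real \<Rightarrow> 's \<Rightarrow> 's \<Rightarrow> real"
  assumes finite_S: "finite S"
    and X_measurable: "\<And>t. 0 \<le> t \<Longrightarrow> X t \<in> M \<rightarrow>\<^sub>M count_space S"
    and X_right_cont: "\<And>\<omega> t. \<omega> \<in> space M \<Longrightarrow> 0 \<le> t \<Longrightarrow> continuous (at_right t) (\<lambda>s. X s \<omega>)"
    and p_transition: "transition_function S p"
    and p_rates: "has_transition_rates S p q"
    and X_markov: "markov_property M S p X"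

lemma finite_markov_process_imp_chain:
  assumes "finite_markov_process M S q X"
  obtains p where "finite_markov_chain M S q X p"
  using assms unfolding finite_markov_process_def finite_markov_chain_def
    finite_markov_chain_axioms_def by blast

context finite_markov_chain
begin

lemma X_in_S: "\<omega> \<in> space M \<Longrightarrow> 0 \<le> t \<Longrightarrow> X t \<omega> \<in> S"
  using measurable_space[OF X_measurable] by auto

lemma X_event: "0 \<le> t \<Longrightarrow> {\<omega> \<in> space M. P (X t \<omega>)} \<in> events"
proof -
  assume t: "0 \<le> t"
  have "{\<omega> \<in> space M. P (X t \<omega>)} = X t -` {x\<in>S. P x} \<inter> space M"
    using X_in_S[OF _ t] by auto
  then show ?thesis using measurable_sets[OF X_measurable[OF t], of "{x\<in>S. P x}"] by simp
qed

section \<open>Taboo probabilities of the process sampled on a time grid\<close>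

lemma skeleton_event:
  assumes "0 \<le> d"
  shows "{\<omega> \<in> space M. \<forall>i\<le>n::nat. P i (X (real i * d) \<omega>)} \<in> events"
proof -
  have "{\<omega> \<in> space M. \<forall>i\<le>n. P i (X (real i * d) \<omega>)} =
      space M \<inter> (\<Inter>i\<in>{..n}. {\<omega> \<in> space M. P i (X (real i * d) \<omega>)})" by auto
  also have "\<dots> \<in> events" using assms by (intro sets.Int sets.top sets.finite_INT X_event) auto
  finally show ?thesis .
qed

text \<open>\<open>markov_property\<close> speaks only of conditioning events of nonzero
  probability. In product form a null path causes no exception, because both sides are then
  0.\<close>

lemma skeleton_path:
  assumes d: "0 < d" and y: "y \<in> S"
  shows "prob {\<omega> \<in> space M. (\<forall>i\<le>n. X (real i * d) \<omega> = x i) \<and> X (real (Suc n) * d) \<omega> = y} =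
    prob {\<omega> \<in> space M. \<forall>i\<le>n. X (real i * d) \<omega> = x i} * p d (x n) y"
proof (cases "prob {\<omega> \<in> space M. \<forall>i\<le>n. X (real i * d) \<omega> = x i} = 0")
  case True
  have "prob {\<omega> \<in> space M. (\<forall>i\<le>n. X (real i * d) \<omega> = x i) \<and> X (real (Suc n) * d) \<omega> = y}
    \<le> prob {\<omega> \<in> space M. \<forall>i\<le>n. X (real i * d) \<omega> = x i}"
    by (rule finite_measure_mono[OF _ skeleton_event[where P="\<lambda>i z. z = x i"]]) (use d in auto)
  with True show ?thesis
    using measure_nonneg[of M] by (metis (no_types, lifting) mult_zero_left order_antisym)
next
  case False
  have "0 \<le> real 0 * d \<and> (\<forall>i<n. real i * d < real (Suc i) * d) \<and> 0 \<le> d \<and> y \<in> S \<and>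
      prob {\<omega> \<in> space M. \<forall>i\<le>n. X (real i * d) \<omega> = x i} \<noteq> 0"
    using False d y by simp
  then have "cond_prob M (\<lambda>\<omega>. X (real n * d + d) \<omega> = y) (\<lambda>\<omega>. \<forall>i\<le>n. X (real i * d) \<omega> = x i)
      = p d (x n) y"
    by (rule X_markov[unfolded markov_property_def, rule_format, of "\<lambda>i. real i * d"])
  moreover have "real n * d + d = real (Suc n) * d" by (simp add: algebra_simps)
  moreover have "{\<omega> \<in> space M. X (real (Suc n) * d) \<omega> = y \<and> (\<forall>i\<le>n. X (real i * d) \<omega> = x i)} =
      {\<omega> \<in> space M. (\<forall>i\<le>n. X (real i * d) \<omega> = x i) \<and> X (real (Suc n) * d) \<omega> = y}"
    by blast
  ultimately show ?thesis using False
    unfolding cond_prob_def by (simp only: divide_eq_eq mult.commute if_False simp_thms)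
qed

text \<open>These are the taboo probabilities of the sampled chain: its sub-probability law after
  \<open>n\<close> steps when it is killed on leaving \<open>B\<close>.\<close>

definition skeleton_prob :: "'s set \<Rightarrow> real \<Rightarrow> nat \<Rightarrow> 's \<Rightarrow> real" where
  "skeleton_prob B d n z =
    prob {\<omega> \<in> space M. (\<forall>i\<le>n. X (real i * d) \<omega> \<in> B) \<and> X (real n * d) \<omega> = z}"

text \<open>The Markov property conditions on fully prescribed values, so an event that only
  confines the path to \<open>B\<close> has to be split into the finitely many paths through
  \<open>B\<close>. \<open>Q\<close> prescribes the end point and \<open>R\<close> leaves room for
  one further step.\<close>

lemma skeleton_paths:
  assumes d: "0 < d" and B: "B \<subseteq> S" and R: "{\<omega>\<in>space M. R \<omega>} \<in> events"
  shows "prob {\<omega> \<in> space M. (\<forall>i\<le>n. X (real i * d) \<omega> \<in> B) \<and> Q (X (real n * d) \<omega>) \<and> R \<omega>} =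
    (\<Sum>x | x \<in> PiE {..n} (\<lambda>_. B) \<and> Q (x n).
        prob {\<omega> \<in> space M. (\<forall>i\<le>n. X (real i * d) \<omega> = x i) \<and> R \<omega>})"
proof -
  let ?F = "{x. x \<in> PiE {..n} (\<lambda>_. B) \<and> Q (x n)}"
  let ?A = "\<lambda>x. {\<omega> \<in> space M. (\<forall>i\<le>n. X (real i * d) \<omega> = x i) \<and> R \<omega>}"
  have finB: "finite B" using B finite_S finite_subset by blast
  have fin: "finite ?F"
    by (rule finite_subset[of _ "PiE {..n} (\<lambda>_. B)"]) (auto intro!: finite_PiE finB)
  have eq: "{\<omega> \<in> space M. (\<forall>i\<le>n. X (real i * d) \<omega> \<in> B) \<and> Q (X (real n * d) \<omega>) \<and> R \<omega>}
      = (\<Union>x\<in>?F. ?A x)" (is "?L = ?U")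
  proof
    show "?U \<subseteq> ?L" by (auto simp: PiE_iff)
    show "?L \<subseteq> ?U"
    proof
      fix \<omega> assume w: "\<omega> \<in> ?L"
      then have "\<omega> \<in> ?A (restrict (\<lambda>i. X (real i * d) \<omega>) {..n})"
        "restrict (\<lambda>i. X (real i * d) \<omega>) {..n} \<in> ?F" by auto
      then show "\<omega> \<in> ?U" by blast
    qed
  qed
  have ev: "?A x \<in> events" for x
  proof -
    have "?A x = {\<omega> \<in> space M. \<forall>i\<le>n. X (real i * d) \<omega> = x i} \<inter> {\<omega>\<in>space M. R \<omega>}" by auto
    also have "\<dots> \<in> events"
      by (rule sets.Int[OF skeleton_event[where P="\<lambda>i z. z = x i"] R]) (use d in simp)
    finally show ?thesis .
  qed
  have dis: "disjoint_family_on ?A ?F"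
    unfolding disjoint_family_on_def
  proof (intro ballI impI)
    fix x y assume xy: "x \<in> ?F" "y \<in> ?F" "x \<noteq> y"
    \<comment> \<open>Members of \<open>PiE\<close> agree outside \<open>{..n}\<close>, so distinct
      ones already differ at an index up to \<open>n\<close>.\<close>
    then obtain i where "i \<le> n" "x i \<noteq> y i"
      by (metis (mono_tags, lifting) PiE_ext atMost_iff mem_Collect_eq)
    then show "?A x \<inter> ?A y = {}" by auto
  qed
  show ?thesis unfolding eq
    by (rule finite_measure_finite_Union[OF fin image_subsetI[OF ev] dis])
qed

text \<open>This is the Chapman-Kolmogorov equation of the killed chain. The transition factor
  depends on a path only through its last state, so grouping the paths by that state reassembles the
  taboo probabilities.\<close>

lemma skeleton_prob_Suc:
  assumes d: "0 < d" and B: "B \<subseteq> S" and y: "y \<in> B"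
  shows "skeleton_prob B d (Suc n) y = (\<Sum>z\<in>B. skeleton_prob B d n z * p d z y)"
proof -
  let ?P = "\<lambda>x. prob {\<omega> \<in> space M. \<forall>i\<le>n. X (real i * d) \<omega> = x i}"
  have finB: "finite B" using B finite_S finite_subset by blast
  have ev: "{\<omega> \<in> space M. X (real (Suc n) * d) \<omega> = y} \<in> events"
    using d by (intro X_event) auto
  have "skeleton_prob B d (Suc n) y =
     prob {\<omega> \<in> space M. (\<forall>i\<le>n. X (real i * d) \<omega> \<in> B) \<and> True \<and> X (real (Suc n) * d) \<omega> = y}"
    unfolding skeleton_prob_def using y by (intro arg_cong[where f=prob]) (auto simp: le_Suc_eq)
  also have "\<dots> = (\<Sum>x\<in>PiE {..n} (\<lambda>_. B). ?P x * p d (x n) y)"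
    using skeleton_paths[OF d B ev, of n "\<lambda>_. True"] y B skeleton_path[OF d, of y n]
    by (auto simp del: of_nat_Suc)
  also have "\<dots> = (\<Sum>z\<in>B. \<Sum>x\<in>{x \<in> PiE {..n} (\<lambda>_. B). x n = z}. ?P x * p d (x n) y)"
    by (intro sum.group[symmetric] finite_PiE finB) auto
  also have "\<dots> = (\<Sum>z\<in>B. skeleton_prob B d n z * p d z y)"
  proof (rule sum.cong[OF refl])
    fix z
    show "(\<Sum>x\<in>{x \<in> PiE {..n} (\<lambda>_. B). x n = z}. ?P x * p d (x n) y) = skeleton_prob B d n z * p d z y"
      using skeleton_paths[OF d B, of "\<lambda>_. True" n "\<lambda>w. w = z"]
      by (auto simp: skeleton_prob_def sum_distrib_right intro!: sum.cong)
  qed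
  finally show ?thesis .
qed

lemma skeleton_sum_Suc:
  assumes d: "0 < d" and B: "B \<subseteq> S"
  shows "(\<Sum>y\<in>B. skeleton_prob B d (Suc n) y * f y) =
    (\<Sum>z\<in>B. skeleton_prob B d n z * (\<Sum>y\<in>B. p d z y * f y))"
proof -
  have "(\<Sum>y\<in>B. skeleton_prob B d (Suc n) y * f y) =
      (\<Sum>y\<in>B. \<Sum>z\<in>B. skeleton_prob B d n z * p d z y * f y)"
    by (simp add: skeleton_prob_Suc[OF d B] sum_distrib_right)
  also have "\<dots> = (\<Sum>z\<in>B. \<Sum>y\<in>B. skeleton_prob B d n z * p d z y * f y)"
    by (rule sum.swap)
  finally show ?thesis by (simp add: sum_distrib_left mult_ac)
qed

text \<open>By \<open>skeleton_sum_Suc\<close> the kernel can act on \<open>f\<close> instead of on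
  the law, so a one-step inequality for \<open>f\<close> iterates. Monotonicity rests on the signs
  of \<open>skeleton_prob\<close> and \<open>c\<close> alone; \<open>f\<close> may be negative, and
  the reverse inequality follows by passing to \<open>- f\<close>.\<close>

lemma skeleton_sum_le:
  assumes d: "0 < d" and B: "B \<subseteq> S" and c: "0 \<le> c"
    and le: "\<And>z. z \<in> B \<Longrightarrow> (\<Sum>y\<in>B. p d z y * f y) \<le> c * f z"
  shows "(\<Sum>y\<in>B. skeleton_prob B d n y * f y) \<le> c ^ n * (\<Sum>y\<in>B. skeleton_prob B d 0 y * f y)"
proof (induction n)
  case (Suc n)
  have "(\<Sum>y\<in>B. skeleton_prob B d (Suc n) y * f y) \<le> (\<Sum>z\<in>B. skeleton_prob B d n z * (c * f z))"
    unfolding skeleton_sum_Suc[OF d B]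
    by (intro sum_mono mult_left_mono le) (auto simp: skeleton_prob_def)
  also have "\<dots> = c * (\<Sum>y\<in>B. skeleton_prob B d n y * f y)"
    by (simp add: sum_distrib_left mult_ac)
  also have "\<dots> \<le> c * (c ^ n * (\<Sum>y\<in>B. skeleton_prob B d 0 y * f y))"
    by (intro mult_left_mono Suc c)
  finally show ?case by (simp add: mult_ac)
qed simp

lemma skeleton_sum_ge:
  assumes d: "0 < d" and B: "B \<subseteq> S" and c: "0 \<le> c"
    and ge: "\<And>z. z \<in> B \<Longrightarrow> (\<Sum>y\<in>B. p d z y * f y) \<ge> c * f z"
  shows "(\<Sum>y\<in>B. skeleton_prob B d n y * f y) \<ge> c ^ n * (\<Sum>y\<in>B. skeleton_prob B d 0 y * f y)"
  using skeleton_sum_le[OF d B c, of "\<lambda>y. - f y"] ge by (simp add: sum_negf)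

lemma skeleton_prob_initial:
  assumes "AE \<omega> in M. X 0 \<omega> = x0" and "x0 \<in> B" "finite B"
  shows "(\<Sum>y\<in>B. skeleton_prob B d 0 y * f y) = f x0"
proof -
  have "skeleton_prob B d 0 y = (if y = x0 then 1 else 0)" if "y \<in> B" for y
  proof (cases "y = x0")
    case True
    have "prob {\<omega> \<in> space M. X 0 \<omega> = x0} = 1"
      using assms(1) X_event[of 0 "\<lambda>z. z = x0"] by (simp add: prob_Collect_eq_1)
    moreover have "{\<omega> \<in> space M. (\<forall>i\<le>0::nat. X (real i * d) \<omega> \<in> B) \<and> X (real 0 * d) \<omega> = y}
      = {\<omega> \<in> space M. X 0 \<omega> = x0}" using True assms(2) by auto
    ultimately show ?thesis using True by (simp add: skeleton_prob_def)
  next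
    case False
    have "prob {\<omega> \<in> space M. X 0 \<omega> = y} = 0"
      using assms(1) False X_event[of 0 "\<lambda>z. z = y"] by (subst prob_Collect_eq_0) auto
    moreover have "{\<omega> \<in> space M. (\<forall>i\<le>0::nat. X (real i * d) \<omega> \<in> B) \<and> X (real 0 * d) \<omega> = y}
      = {\<omega> \<in> space M. X 0 \<omega> = y}" using that by auto
    ultimately show ?thesis using False by (simp add: skeleton_prob_def)
  qed
  then have "(\<Sum>y\<in>B. skeleton_prob B d 0 y * f y) = (\<Sum>y\<in>B. if y = x0 then f y else 0)"
    by (intro sum.cong) auto
  then show ?thesis using assms(2,3) by simp
qed

lemma sum_skeleton_prob:
  assumes d: "0 < d" and B: "B \<subseteq> S"
  shows "(\<Sum>y\<in>B. skeleton_prob B d n y) = prob {\<omega> \<in> space M. \<forall>i\<le>n. X (real i * d) \<omega> \<in> B}"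
proof -
  have finB: "finite B" using B finite_S finite_subset by blast
  let ?A = "\<lambda>z. {\<omega> \<in> space M. (\<forall>i\<le>n. X (real i * d) \<omega> \<in> B) \<and> X (real n * d) \<omega> = z}"
  have ev: "?A z \<in> events" for z
  proof -
    have "?A z = {\<omega> \<in> space M. \<forall>i\<le>n. X (real i * d) \<omega> \<in> B} \<inter> {\<omega>\<in>space M. X (real n * d) \<omega> = z}"
      by auto
    also have "\<dots> \<in> events"
      by (rule sets.Int[OF skeleton_event[where P="\<lambda>i z. z \<in> B"] X_event[where P="\<lambda>w. w = z"]]) (use d in simp_all)
    finally show ?thesis .
  qed
  have "prob (\<Union>z\<in>B. ?A z) = (\<Sum>z\<in>B. prob (?A z))"
    by (rule finite_measure_finite_Union[OF finB image_subsetI[OF ev]])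
      (auto simp: disjoint_family_on_def)
  moreover have "(\<Union>z\<in>B. ?A z) = {\<omega> \<in> space M. \<forall>i\<le>n. X (real i * d) \<omega> \<in> B}" by auto
  ultimately show ?thesis by (simp add: skeleton_prob_def)
qed

section \<open>The generator as the derivative of the transition function at time 0\<close>

definition generator :: "('s \<Rightarrow> real) \<Rightarrow> 's \<Rightarrow> real" where
  "generator f x = (\<Sum>y\<in>S. q x y * (f y - f x))"

text \<open>Row sums equal to 1 turn \<open>f x\<close> into a sum over \<open>y\<close>. Only
  differences \<open>f y - f x\<close> remain, so the diagonal term vanishes identically and the
  off-diagonal rates give the limit.\<close>

lemma generator_limit:
  assumes x: "x \<in> S"
  shows "((\<lambda>h. ((\<Sum>y\<in>S. p h x y * f y) - f x) / h) \<longlongrightarrow> generator f x) (at_right 0)"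
proof -
  have "((\<lambda>h. \<Sum>y\<in>S. p h x y / h * (f y - f x)) \<longlongrightarrow> generator f x) (at_right 0)"
    unfolding generator_def
  proof (rule tendsto_sum)
    fix y assume y: "y \<in> S"
    show "((\<lambda>h. p h x y / h * (f y - f x)) \<longlongrightarrow> q x y * (f y - f x)) (at_right 0)"
    proof (cases "x = y")
      case False
      then show ?thesis using p_rates x y unfolding has_transition_rates_def
        by (intro tendsto_mult) auto
    qed simp
  qed
  moreover have "eventually (\<lambda>h. (\<Sum>y\<in>S. p h x y / h * (f y - f x)) =
      ((\<Sum>y\<in>S. p h x y * f y) - f x) / h) (at_right 0)"
    unfolding eventually_at_filter
  proof (intro always_eventually allI impI)
    fix h :: real assume h: "h \<in> {0<..}"
    have "(\<Sum>y\<in>S. p h x y) = 1"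
      using p_transition x h unfolding transition_function_def by auto
    then have "f x = (\<Sum>y\<in>S. p h x y * f x)" by (simp add: sum_distrib_right[symmetric])
    then have "(\<Sum>y\<in>S. p h x y * f y) - f x = (\<Sum>y\<in>S. p h x y * (f y - f x))"
      by (simp add: algebra_simps sum_subtractf)
    then show "(\<Sum>y\<in>S. p h x y / h * (f y - f x)) = ((\<Sum>y\<in>S. p h x y * f y) - f x) / h"
      by (simp add: sum_divide_distrib)
  qed
  ultimately show ?thesis by (rule Lim_transform_eventually)
qed

text \<open>In a discrete topology \<open>{a}\<close> is open, so right continuity means being
  constant on an interval to the right.\<close>

lemma right_stays:
  assumes "\<omega> \<in> space M" "0 \<le> s" "X s \<omega> = a"
  obtains \<eta> where "\<eta> > 0" "\<And>u. s \<le> u \<Longrightarrow> u < s + \<eta> \<Longrightarrow> X u \<omega> = a"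
proof -
  have "((\<lambda>u. X u \<omega>) \<longlongrightarrow> X s \<omega>) (at_right s)"
    using X_right_cont[OF assms(1,2)] by (simp add: continuous_within)
  then have "eventually (\<lambda>u. X u \<omega> \<in> {a}) (at_right s)"
    by (rule topological_tendstoD) (use assms(3) in \<open>auto intro: discrete_topology_class.open_discrete\<close>)
  then obtain b where b: "b > s" "\<And>u. u > s \<Longrightarrow> u < b \<Longrightarrow> X u \<omega> = a"
    unfolding eventually_at_right_field by auto
  show ?thesis
  proof (rule that[of "b - s"])
    show "X u \<omega> = a" if "s \<le> u" "u < s + (b - s)" for u
      using that b(2)[of u] assms(3) by (cases "u = s") auto
  qed (use b in simp)
qed

text \<open>A visit before \<open>c\<close> lasts for a while, hence also occurs at a rational time
  before \<open>c\<close>; this reduces the event to a countable union.\<close>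

lemma hitting_time_measurable: "hitting_time X a \<in> borel_measurable M"
proof (rule borel_measurableI_less)
  fix c :: ereal
  have "{\<omega> \<in> space M. hitting_time X a \<omega> < c} =
    (\<Union>r\<in>{r \<in> \<rat>. 0 \<le> r \<and> ereal r < c}. {\<omega> \<in> space M. X r \<omega> = a})" (is "?L = ?R")
  proof
    show "?R \<subseteq> ?L" by (auto simp: hitting_time_less_iff)
    show "?L \<subseteq> ?R"
    proof
      fix \<omega> assume "\<omega> \<in> ?L"
      then obtain s where w: "\<omega> \<in> space M" and s: "0 \<le> s" "ereal s < c" "X s \<omega> = a"
        by (auto simp: hitting_time_less_iff)
      obtain \<eta> where \<eta>: "\<eta> > 0" "\<And>u. s \<le> u \<Longrightarrow> u < s + \<eta> \<Longrightarrow> X u \<omega> = a"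
        using right_stays[OF w s(1,3)] by metis
      obtain b where b: "s < b" "ereal b < c"
        using s(2) ereal_dense2[of "ereal s" c] by auto
      obtain r where r: "r \<in> \<rat>" "s < r" "r < min b (s + \<eta>)"
        using Rats_dense_in_real[of s "min b (s + \<eta>)"] b \<eta>(1) by auto
      have "ereal r < ereal b" using r by simp
      then have "ereal r < c" using b(2) by (rule less_trans)
      then show "\<omega> \<in> ?R" using w r s(1) \<eta>(2)[of r] by auto
    qed
  qed
  also have "?R \<in> events"
  proof (rule sets.countable_UN')
    show "countable {r \<in> \<rat>. 0 \<le> r \<and> ereal r < c}"
      by (rule countable_subset[OF _ countable_rat]) auto
  qed (auto intro!: X_event)
  finally show "{\<omega> \<in> space M. hitting_time X a \<omega> < c} \<in> events" .
qed

text \<open>The generator is only a derivative at 0. Positivity of \<open>f x\<close> and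
  \<open>e\<close> makes its bound strict, and a strict bound on the limit passes to all small
  \<open>h\<close>, uniformly over the finite state space. The condition \<open>f a = 0\<close>
  turns the sum over \<open>S\<close> into the sum for the chain killed at \<open>a\<close>.\<close>

lemma eventually_one_step_le:
  assumes fa: "f a = 0" and a: "a \<in> S" and e: "0 < e"
    and pos: "\<And>x. x \<in> S - {a} \<Longrightarrow> 0 < f x"
    and gen: "\<And>x. x \<in> S - {a} \<Longrightarrow> generator f x \<le> - k * f x"
  shows "\<forall>\<^sub>F h in at_right 0. \<forall>x\<in>S - {a}. (\<Sum>y\<in>S - {a}. p h x y * f y) \<le> (1 - h * (k - e)) * f x"
proof (rule eventually_ball_finite)
  show "finite (S - {a})" using finite_S by simp
  show "\<forall>x\<in>S - {a}. \<forall>\<^sub>F h in at_right 0. (\<Sum>y\<in>S - {a}. p h x y * f y) \<le> (1 - h * (k - e)) * f x"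
  proof
    fix x assume x: "x \<in> S - {a}"
    have "generator f x < - (k - e) * f x"
      using gen[OF x] mult_pos_pos[OF e pos[OF x]] by (simp add: algebra_simps)
    then have "\<forall>\<^sub>F h in at_right 0. ((\<Sum>y\<in>S. p h x y * f y) - f x) / h < - (k - e) * f x"
      using generator_limit[of x f] x by (auto intro: order_tendstoD)
    moreover have "\<forall>\<^sub>F h::real in at_right 0. 0 < h" by (simp add: eventually_at_right_less)
    ultimately show "\<forall>\<^sub>F h in at_right 0. (\<Sum>y\<in>S - {a}. p h x y * f y) \<le> (1 - h * (k - e)) * f x"
    proof eventually_elim
      case (elim h)
      have "(\<Sum>y\<in>S. p h x y * f y) = (\<Sum>y\<in>S - {a}. p h x y * f y)"
        using fa a finite_S by (subst sum.remove[of _ a]) auto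
      moreover have "(\<Sum>y\<in>S. p h x y * f y) - f x < - (k - e) * f x * h"
        using elim by (simp add: pos_divide_less_eq)
      ultimately show ?case by (simp add: algebra_simps)
    qed
  qed
qed

lemma eventually_one_step_ge:
  assumes fa: "f a = 0" and a: "a \<in> S" and e: "0 < e"
    and pos: "\<And>x. x \<in> S - {a} \<Longrightarrow> 0 < f x"
    and gen: "\<And>x. x \<in> S - {a} \<Longrightarrow> - k * f x \<le> generator f x"
  shows "\<forall>\<^sub>F h in at_right 0. \<forall>x\<in>S - {a}. (1 - h * (k + e)) * f x \<le> (\<Sum>y\<in>S - {a}. p h x y * f y)"
proof (rule eventually_ball_finite)
  show "finite (S - {a})" using finite_S by simp
  show "\<forall>x\<in>S - {a}. \<forall>\<^sub>F h in at_right 0. (1 - h * (k + e)) * f x \<le> (\<Sum>y\<in>S - {a}. p h x y * f y)"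
  proof
    fix x assume x: "x \<in> S - {a}"
    have "- (k + e) * f x < generator f x"
      using gen[OF x] mult_pos_pos[OF e pos[OF x]] by (simp add: algebra_simps)
    then have "\<forall>\<^sub>F h in at_right 0. - (k + e) * f x < ((\<Sum>y\<in>S. p h x y * f y) - f x) / h"
      using generator_limit[of x f] x by (auto intro: order_tendstoD)
    moreover have "\<forall>\<^sub>F h::real in at_right 0. 0 < h" by (simp add: eventually_at_right_less)
    ultimately show "\<forall>\<^sub>F h in at_right 0. (1 - h * (k + e)) * f x \<le> (\<Sum>y\<in>S - {a}. p h x y * f y)"
    proof eventually_elim
      case (elim h)
      have "(\<Sum>y\<in>S. p h x y * f y) = (\<Sum>y\<in>S - {a}. p h x y * f y)"
        using fa a finite_S by (subst sum.remove[of _ a]) auto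
      moreover have "- (k + e) * f x * h < (\<Sum>y\<in>S. p h x y * f y) - f x"
        using elim by (simp add: pos_less_divide_eq)
      ultimately show ?case by (simp add: algebra_simps)
    qed
  qed
qed

text \<open>Survival beyond \<open>t\<close> forces the process to avoid \<open>a\<close> on the
  grid. Since \<open>f \<ge> 1\<close>, the probability of that is at most the taboo expectation of
  \<open>f\<close>, which decays geometrically. Let the mesh tend to 0, then
  \<open>e\<close>.\<close>

lemma hitting_time_gt_le:
  assumes fa: "f a = 0" and a: "a \<in> S"
    and ge1: "\<And>x. x \<in> S - {a} \<Longrightarrow> 1 \<le> f x"
    and gen: "\<And>x. x \<in> S - {a} \<Longrightarrow> generator f x \<le> - k * f x"
    and init: "AE \<omega> in M. X 0 \<omega> = x0" "x0 \<in> S - {a}"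
    and t: "0 < t"
  shows "prob {\<omega> \<in> space M. ereal t < hitting_time X a \<omega>} \<le> f x0 * exp (- k * t)"
proof -
  have "prob {\<omega> \<in> space M. ereal t < hitting_time X a \<omega>} \<le> f x0 * exp (- (k - e) * t)"
    if e: "0 < e" for e
  proof (rule tendsto_lowerbound[OF grid_factor_limit])
    have "\<forall>\<^sub>F h in at_right 0. \<forall>x\<in>S - {a}. (\<Sum>y\<in>S - {a}. p h x y * f y) \<le> (1 - h * (k - e)) * f x"
      using ge1 by (intro eventually_one_step_le fa a e gen) force+
    then have "\<forall>\<^sub>F n in sequentially. \<forall>x\<in>S - {a}.
        (\<Sum>y\<in>S - {a}. p (t / real n) x y * f y) \<le> (1 - t / real n * (k - e)) * f x"
      by (rule eventually_compose_filterlim[OF _ filterlim_grid_step[OF t]])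
    with grid_factor_nonneg[of t "k - e"] eventually_gt_at_top[of 0]
    show "\<forall>\<^sub>F n in sequentially. prob {\<omega> \<in> space M. ereal t < hitting_time X a \<omega>}
      \<le> f x0 * (1 - t / real n * (k - e)) ^ n"
    proof eventually_elim
      case (elim n)
      have d: "0 < t / real n" using t elim by simp
      have "{\<omega> \<in> space M. ereal t < hitting_time X a \<omega>} \<subseteq>
          {\<omega> \<in> space M. \<forall>i\<le>n. X (real i * (t / real n)) \<omega> \<in> S - {a}}"
      proof safe
        fix \<omega> i assume w: "\<omega> \<in> space M" "ereal t < hitting_time X (X (real i * (t / real n)) \<omega>) \<omega>" "i \<le> n"
        have "real i * (t / real n) \<le> t" "0 \<le> real i * (t / real n)"
          using t elim w(3) by (auto simp: field_simps)
        then have "hitting_time X (X (real i * (t / real n)) \<omega>) \<omega> \<le> ereal t"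
          unfolding hitting_time_def by (intro Inf_lower2[of "ereal (real i * (t / real n))"]) auto
        then show False using w(2) by simp
      qed (use X_in_S t in auto)
      then have "prob {\<omega> \<in> space M. ereal t < hitting_time X a \<omega>} \<le>
          prob {\<omega> \<in> space M. \<forall>i\<le>n. X (real i * (t / real n)) \<omega> \<in> S - {a}}"
        by (rule finite_measure_mono)
          (rule skeleton_event[where P="\<lambda>i z. z \<in> S - {a}"], use d in simp)
      also have "\<dots> = (\<Sum>y\<in>S - {a}. skeleton_prob (S - {a}) (t / real n) n y)"
        by (rule sum_skeleton_prob[OF d, symmetric]) auto
      also have "\<dots> \<le> (\<Sum>y\<in>S - {a}. skeleton_prob (S - {a}) (t / real n) n y * f y)"
      proof (rule sum_mono)
        fix y assume "y \<in> S - {a}"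
        then show "skeleton_prob (S - {a}) (t / real n) n y \<le> skeleton_prob (S - {a}) (t / real n) n y * f y"
          using mult_left_mono[OF ge1, of y "skeleton_prob (S - {a}) (t / real n) n y"]
          by (simp add: skeleton_prob_def)
      qed
      also have "\<dots> \<le> (1 - t / real n * (k - e)) ^ n *
          (\<Sum>y\<in>S - {a}. skeleton_prob (S - {a}) (t / real n) 0 y * f y)"
        using elim by (intro skeleton_sum_le[OF d]) auto
      also have "\<dots> = f x0 * (1 - t / real n * (k - e)) ^ n"
        using finite_S by (subst skeleton_prob_initial[OF init]) auto
      finally show ?case .
    qed
  qed simp
  then have *: "\<forall>\<^sub>F e in at_right 0. prob {\<omega> \<in> space M. ereal t < hitting_time X a \<omega>} \<le> f x0 * exp (- (k - e) * t)"
    by (simp add: eventually_at_filter)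
  have "((\<lambda>e. f x0 * exp (- (k - e) * t)) \<longlongrightarrow> f x0 * exp (- (k - 0) * t)) (at_right 0)"
    by (intro tendsto_intros)
  from tendsto_lowerbound[OF this *] show ?thesis by simp
qed

text \<open>Now \<open>f \<le> 1\<close> bounds the probability of avoidance on a grid from below.
  Along powers of two the avoidance events decrease, so their intersection satisfies the limiting
  bound; a path in it cannot visit \<open>a\<close> before \<open>t\<close>, as it would then rest
  there at a dyadic time.\<close>

lemma hitting_time_ge_ge:
  assumes fa: "f a = 0" and a: "a \<in> S"
    and pos: "\<And>x. x \<in> S - {a} \<Longrightarrow> 0 < f x" and le1: "\<And>x. x \<in> S - {a} \<Longrightarrow> f x \<le> 1"
    and gen: "\<And>x. x \<in> S - {a} \<Longrightarrow> - k * f x \<le> generator f x"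
    and init: "AE \<omega> in M. X 0 \<omega> = x0" "x0 \<in> S - {a}"
    and t: "0 < t"
  shows "f x0 * exp (- k * t) \<le> prob {\<omega> \<in> space M. ereal t \<le> hitting_time X a \<omega>}"
proof -
  define G where "G = (\<lambda>n. {\<omega> \<in> space M. \<forall>i\<le>n. X (real i * (t / real n)) \<omega> \<in> S - {a}})"
  have G_event: "G n \<in> events" for n
    unfolding G_def using t by (intro skeleton_event[where P="\<lambda>i z. z \<in> S - {a}"]) simp
  have bound: "f x0 * exp (- (k + e) * t) \<le> prob (\<Inter>m. G (2 ^ m))" if e: "0 < e" for e
  proof -
    have "\<forall>\<^sub>F h in at_right 0. \<forall>x\<in>S - {a}. (1 - h * (k + e)) * f x \<le> (\<Sum>y\<in>S - {a}. p h x y * f y)"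
      by (intro eventually_one_step_ge fa a e gen pos)
    then have "\<forall>\<^sub>F n in sequentially. \<forall>x\<in>S - {a}.
        (1 - t / real n * (k + e)) * f x \<le> (\<Sum>y\<in>S - {a}. p (t / real n) x y * f y)"
      by (rule eventually_compose_filterlim[OF _ filterlim_grid_step[OF t]])
    with grid_factor_nonneg[of t "k + e"] eventually_gt_at_top[of 0]
    have ev: "\<forall>\<^sub>F n in sequentially. f x0 * (1 - t / real n * (k + e)) ^ n \<le> prob (G n)"
    proof eventually_elim
      case (elim n)
      have d: "0 < t / real n" using t elim by simp
      have "f x0 * (1 - t / real n * (k + e)) ^ n = (1 - t / real n * (k + e)) ^ n *
          (\<Sum>y\<in>S - {a}. skeleton_prob (S - {a}) (t / real n) 0 y * f y)"
        using finite_S by (subst skeleton_prob_initial[OF init]) auto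
      also have "\<dots> \<le> (\<Sum>y\<in>S - {a}. skeleton_prob (S - {a}) (t / real n) n y * f y)"
        using elim by (intro skeleton_sum_ge[OF d]) auto
      also have "\<dots> \<le> (\<Sum>y\<in>S - {a}. skeleton_prob (S - {a}) (t / real n) n y)"
        using le1 by (intro sum_mono mult_left_le) (auto simp: skeleton_prob_def)
      also have "\<dots> = prob (G n)"
        unfolding G_def by (rule sum_skeleton_prob[OF d]) auto
      finally show ?case .
    qed
    have pow: "filterlim (\<lambda>m::nat. 2 ^ m :: nat) sequentially sequentially"
      by (rule filterlim_subseq) (simp add: strict_mono_def)
    \<comment> \<open>Point \<open>i\<close> of the grid with \<open>2 ^ m\<close> steps is point
      \<open>2 * i\<close> of the next one.\<close>
    have "decseq (\<lambda>m. G (2 ^ m))"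
    proof (rule decseq_SucI, rule subsetI)
      fix m \<omega> assume w: "\<omega> \<in> G (2 ^ Suc m)"
      show "\<omega> \<in> G (2 ^ m)"
        unfolding G_def
      proof (intro CollectI conjI allI impI)
        fix i :: nat assume i: "i \<le> 2 ^ m"
        then have "2 * i \<le> 2 ^ Suc m" by simp
        then have "X (real (2 * i) * (t / real (2 ^ Suc m))) \<omega> \<in> S - {a}"
          using w unfolding G_def by blast
        moreover have "real (2 * i) * (t / real (2 ^ Suc m)) = real i * (t / real (2 ^ m))" by simp
        ultimately show "X (real i * (t / real (2 ^ m))) \<omega> \<in> S - {a}" by (simp only:)
      qed (use w in \<open>simp add: G_def\<close>)
    qed
    then have "(\<lambda>m. prob (G (2 ^ m))) \<longlonglongrightarrow> prob (\<Inter>m. G (2 ^ m))"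
      using G_event by (intro finite_Lim_measure_decseq) auto
    moreover have "(\<lambda>m. f x0 * (1 - t / real (2 ^ m) * (k + e)) ^ (2 ^ m)) \<longlonglongrightarrow> f x0 * exp (- (k + e) * t)"
      using filterlim_compose[OF grid_factor_limit pow, of "f x0" t "k + e"] by simp
    moreover have "\<forall>\<^sub>F m in sequentially. f x0 * (1 - t / real (2 ^ m) * (k + e)) ^ (2 ^ m) \<le> prob (G (2 ^ m))"
      using ev pow unfolding filterlim_iff by blast
    ultimately show ?thesis by (intro tendsto_le[OF sequentially_bot])
  qed
  then have *: "\<forall>\<^sub>F e in at_right 0. f x0 * exp (- (k + e) * t) \<le> prob (\<Inter>m. G (2 ^ m))"
    by (simp add: eventually_at_filter)
  have "((\<lambda>e. f x0 * exp (- (k + e) * t)) \<longlongrightarrow> f x0 * exp (- (k + 0) * t)) (at_right 0)"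
    by (intro tendsto_intros)
  from tendsto_upperbound[OF this *]
  have "f x0 * exp (- k * t) \<le> prob (\<Inter>m. G (2 ^ m))" by simp
  also have "(\<Inter>m. G (2 ^ m)) \<subseteq> {\<omega> \<in> space M. ereal t \<le> hitting_time X a \<omega>}"
  proof
    fix \<omega> assume w: "\<omega> \<in> (\<Inter>m. G (2 ^ m))"
    then have sp: "\<omega> \<in> space M" by (auto simp: G_def)
    have "\<not> hitting_time X a \<omega> < ereal t"
    proof
      assume "hitting_time X a \<omega> < ereal t"
      then obtain s where s: "0 \<le> s" "s < t" "X s \<omega> = a" by (auto simp: hitting_time_less_iff)
      obtain \<eta> where \<eta>: "\<eta> > 0" "\<And>u. s \<le> u \<Longrightarrow> u < s + \<eta> \<Longrightarrow> X u \<omega> = a"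
        using right_stays[OF sp s(1,3)] by metis
      \<comment> \<open>The cap at \<open>t\<close> keeps the grid point within the sampled range,
        the cap at \<open>s + \<eta>\<close> within the stay in \<open>a\<close>.\<close>
      obtain m i :: nat where mi: "i \<le> 2 ^ m" "s \<le> real i * (t / real (2 ^ m))"
          "real i * (t / real (2 ^ m)) < min t (s + \<eta>)"
      proof (rule dyadic_between[of t s "min t (s + \<eta>)"])
      qed (use t s \<eta> in auto)
      have "\<omega> \<in> G (2 ^ m)" using w by blast
      then have "X (real i * (t / real (2 ^ m))) \<omega> \<in> S - {a}" using mi(1) unfolding G_def by blast
      moreover have "X (real i * (t / real (2 ^ m))) \<omega> = a" using mi by (intro \<eta>(2)) auto
      ultimately show False by blast
    qed
    then show "\<omega> \<in> {\<omega> \<in> space M. ereal t \<le> hitting_time X a \<omega>}" using sp by (simp add: not_less)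
  qed
  then have "prob (\<Inter>m. G (2 ^ m)) \<le> prob {\<omega> \<in> space M. ereal t \<le> hitting_time X a \<omega>}"
    using hitting_time_measurable[of a] by (intro finite_measure_mono) auto
  finally show ?thesis .
qed

text \<open>The previous bound at \<open>t + e\<close>, with \<open>e\<close> tending to 0, yields
  the strict event and also covers \<open>t = 0\<close>.\<close>

lemma hitting_time_gt_ge:
  assumes fa: "f a = 0" and a: "a \<in> S"
    and pos: "\<And>x. x \<in> S - {a} \<Longrightarrow> 0 < f x" and le1: "\<And>x. x \<in> S - {a} \<Longrightarrow> f x \<le> 1"
    and gen: "\<And>x. x \<in> S - {a} \<Longrightarrow> - k * f x \<le> generator f x"
    and init: "AE \<omega> in M. X 0 \<omega> = x0" "x0 \<in> S - {a}"
    and t: "0 \<le> t"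
  shows "f x0 * exp (- k * t) \<le> prob {\<omega> \<in> space M. ereal t < hitting_time X a \<omega>}"
proof -
  have "f x0 * exp (- k * (t + e)) \<le> prob {\<omega> \<in> space M. ereal t < hitting_time X a \<omega>}"
    if e: "0 < e" for e
  proof -
    have "f x0 * exp (- k * (t + e)) \<le> prob {\<omega> \<in> space M. ereal (t + e) \<le> hitting_time X a \<omega>}"
      using t e by (intro hitting_time_ge_ge assms) auto
    also have "\<dots> \<le> prob {\<omega> \<in> space M. ereal t < hitting_time X a \<omega>}"
    proof (rule finite_measure_mono)
      show "{\<omega> \<in> space M. ereal (t + e) \<le> hitting_time X a \<omega>} \<subseteq> {\<omega> \<in> space M. ereal t < hitting_time X a \<omega>}"
        using e by (auto intro: less_le_trans[of "ereal t" "ereal (t + e)"])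
    qed (use hitting_time_measurable[of a] in measurable)
    finally show ?thesis .
  qed
  then have *: "\<forall>\<^sub>F e in at_right 0. f x0 * exp (- k * (t + e)) \<le> prob {\<omega> \<in> space M. ereal t < hitting_time X a \<omega>}"
    by (simp add: eventually_at_filter)
  have "((\<lambda>e. f x0 * exp (- k * (t + e))) \<longlongrightarrow> f x0 * exp (- k * (t + 0))) (at_right 0)"
    by (intro tendsto_intros)
  from tendsto_upperbound[OF this *] show ?thesis by simp
qed

end

section \<open>Mean hitting times of the Engset process\<close>

text \<open>This is the reversible measure, normalized to be 1 at state 0. When \<mu> + \<nu> = 1,
  multiplying by \<open>\<mu> ^ N\<close> gives the binomial probabilities with parameters
  \<open>N\<close> and \<nu>.\<close>

definition engset_weight :: "nat \<Rightarrow> real \<Rightarrow> real \<Rightarrow> nat \<Rightarrow> real" where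
  "engset_weight N \<nu> \<mu> x = real (N choose x) * (\<nu> / \<mu>) ^ x"

text \<open>The mean time from \<open>x\<close> to \<open>x - 1\<close>: multiplying \<open>L h = - 1\<close> by the reversible weights and summing
  over \<open>{x..C}\<close> leaves only the flux through the edge between \<open>x - 1\<close> and \<open>x\<close>.\<close>

definition engset_descent_mean :: "nat \<Rightarrow> nat \<Rightarrow> real \<Rightarrow> real \<Rightarrow> nat \<Rightarrow> real" where
  "engset_descent_mean N C \<nu> \<mu> x =
     (\<Sum>j=x..C. engset_weight N \<nu> \<mu> j) / (engset_weight N \<nu> \<mu> x * (\<mu> * real x))"

text \<open>Downward jumps have size one, so the way from \<open>x\<close> to 0 passes through every
  level in between.\<close>

definition engset_hitting_mean :: "nat \<Rightarrow> nat \<Rightarrow> real \<Rightarrow> real \<Rightarrow> nat \<Rightarrow> real" where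
  "engset_hitting_mean N C \<nu> \<mu> x = (\<Sum>i=1..x. engset_descent_mean N C \<nu> \<mu> i)"

lemma engset_weight_pos:
  "0 < \<nu> \<Longrightarrow> 0 < \<mu> \<Longrightarrow> x \<le> N \<Longrightarrow> 0 < engset_weight N \<nu> \<mu> x"
  by (simp add: engset_weight_def)

lemma engset_detailed_balance:
  assumes "0 < \<mu>" "x \<le> N"
  shows "engset_weight N \<nu> \<mu> (Suc x) * (\<mu> * real (Suc x)) = engset_weight N \<nu> \<mu> x * (\<nu> * (real N - real x))"
proof -
  have "Suc x * (N choose Suc x) = (N - x) * (N choose x)"
    using binomial_absorb_comp[of N x] binomial_absorption[of x N] by simp
  then have "real (Suc x) * real (N choose Suc x) = (real N - real x) * real (N choose x)"
    using assms(2) by (metis of_nat_diff of_nat_mult)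
  moreover have "engset_weight N \<nu> \<mu> (Suc x) * (\<mu> * real (Suc x)) =
      real (Suc x) * real (N choose Suc x) * \<nu> * (\<nu> / \<mu>) ^ x"
    using assms(1) by (simp add: engset_weight_def del: of_nat_Suc)
  ultimately show ?thesis by (simp add: engset_weight_def mult_ac del: of_nat_Suc)
qed

lemma engset_descent_mean_pos:
  assumes "0 < \<nu>" "0 < \<mu>" "1 \<le> x" "x \<le> C" "C \<le> N"
  shows "0 < engset_descent_mean N C \<nu> \<mu> x"
  unfolding engset_descent_mean_def using assms
  by (intro divide_pos_pos sum_pos mult_pos_pos engset_weight_pos) auto

lemma engset_hitting_mean_0 [simp]: "engset_hitting_mean N C \<nu> \<mu> 0 = 0"
  by (simp add: engset_hitting_mean_def)

lemma engset_hitting_mean_Suc: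
  "engset_hitting_mean N C \<nu> \<mu> (Suc x) = engset_hitting_mean N C \<nu> \<mu> x + engset_descent_mean N C \<nu> \<mu> (Suc x)"
  by (simp add: engset_hitting_mean_def)

lemma engset_hitting_mean_mono:
  assumes "0 < \<nu>" "0 < \<mu>" "x \<le> y" "y \<le> C" "C \<le> N"
  shows "engset_hitting_mean N C \<nu> \<mu> x \<le> engset_hitting_mean N C \<nu> \<mu> y"
  unfolding engset_hitting_mean_def
proof (rule sum_mono2)
  fix i assume "i \<in> {1..y} - {1..x}"
  then show "0 \<le> engset_descent_mean N C \<nu> \<mu> i"
    using assms engset_descent_mean_pos[of \<nu> \<mu> i C N] by simp
qed (use assms in auto)

lemma engset_hitting_mean_1: "engset_hitting_mean N C \<nu> \<mu> 1 = engset_descent_mean N C \<nu> \<mu> 1"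
  by (simp add: engset_hitting_mean_def)

text \<open>Divided by the weight of \<open>x\<close>, the downward jump contributes minus the tail
  sum from \<open>x\<close>, and the upward jump plus the tail sum from \<open>x + 1\<close>; only
  the term of \<open>x\<close> itself survives. At \<open>x = C\<close> the second tail is empty, in
  accordance with the blocked jump.\<close>

lemma engset_hitting_mean_poisson_equation:
  assumes "0 < \<nu>" "0 < \<mu>" "1 \<le> x" "x \<le> C" "C \<le> N"
  shows "(\<Sum>y\<in>{0..C}. engset_rate N C \<nu> \<mu> x y *
    (engset_hitting_mean N C \<nu> \<mu> y - engset_hitting_mean N C \<nu> \<mu> x)) = -1"
proof -
  let ?h = "engset_hitting_mean N C \<nu> \<mu>" and ?w = "engset_weight N \<nu> \<mu>"
  obtain w where x: "x = Suc w" using assms by (cases x) auto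
  have wpos: "0 < ?w x" using assms by (intro engset_weight_pos) auto
  have down: "\<mu> * real x * (?h w - ?h x) = - ((\<Sum>j=x..C. ?w j) / ?w x)"
  proof -
    have "?h x = ?h w + (\<Sum>j=x..C. ?w j) / (?w x * (\<mu> * real x))"
      unfolding x engset_hitting_mean_Suc engset_descent_mean_def ..
    then show ?thesis using wpos assms by simp
  qed
  have up: "(if x < C then \<nu> * (real N - real x) * (?h (Suc x) - ?h x) else 0) = (\<Sum>j=Suc x..C. ?w j) / ?w x"
  proof (cases "x < C")
    case True
    then have pos: "0 < \<nu> * (real N - real x)" using assms by simp
    \<comment> \<open>Detailed balance replaces the downward rate out of \<open>x + 1\<close> by the
      upward rate out of \<open>x\<close>, which then cancels.\<close>
    have "?h (Suc x) - ?h x = (\<Sum>j=Suc x..C. ?w j) / (?w x * (\<nu> * (real N - real x)))"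
      unfolding engset_hitting_mean_Suc engset_descent_mean_def
      using engset_detailed_balance[of \<mu> x N \<nu>] assms by simp
    then show ?thesis using True pos wpos assms by simp
  qed simp
  have "(\<Sum>y\<in>{0..C}. engset_rate N C \<nu> \<mu> x y * (?h y - ?h x)) =
      (\<Sum>y\<in>{0..C}. (if y = w then \<mu> * real x * (?h w - ?h x) else 0) +
        (if y = Suc x then (if x < C then \<nu> * (real N - real x) * (?h (Suc x) - ?h x) else 0) else 0))"
    unfolding engset_rate_def x by (intro sum.cong) auto
  also have "\<dots> = \<mu> * real x * (?h w - ?h x) +
      (if x < C then \<nu> * (real N - real x) * (?h (Suc x) - ?h x) else 0)"
    unfolding sum.distrib using assms x by (simp add: sum.delta)
  also have "\<dots> = - ((?w x + (\<Sum>j=Suc x..C. ?w j)) / ?w x) + (\<Sum>j=Suc x..C. ?w j) / ?w x"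
    unfolding up down using sum.atLeast_Suc_atMost[of x C ?w] assms by simp
  also have "\<dots> = -1" using wpos by (simp add: add_divide_distrib)
  finally show ?thesis .
qed

lemma engset_hitting_time_bounds:
  assumes "engset_process M N C \<nu> \<mu> X" "AE \<omega> in M. X 0 \<omega> = C"
    and pos: "0 < \<nu>" "0 < \<mu>" and C: "1 \<le> C" "C \<le> N" and t: "0 \<le> t"
  defines "h \<equiv> engset_hitting_mean N C \<nu> \<mu>"
  shows "exp (- t / h 1) \<le> measure M {\<omega> \<in> space M. ereal t < hitting_time X 0 \<omega>}"
    and "measure M {\<omega> \<in> space M. ereal t < hitting_time X 0 \<omega>} \<le> h C / h 1 * exp (- t / h C)"
proof -
  obtain p where "finite_markov_chain M {0..C} (engset_rate N C \<nu> \<mu>) X p"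
    using assms(1) unfolding engset_process_def by (rule finite_markov_process_imp_chain)
  then interpret finite_markov_chain M "{0..C}" "engset_rate N C \<nu> \<mu>" X p .
  have h1: "0 < h 1"
    unfolding h_def engset_hitting_mean_1 using pos C by (intro engset_descent_mean_pos) auto
  have h_ge: "h 1 \<le> h x" and h_le: "h x \<le> h C" if "x \<in> {0..C} - {0}" for x
    unfolding h_def using pos C that by (auto intro!: engset_hitting_mean_mono)
  have hC: "0 < h C" using h1 h_ge[of C] C by simp
  have h0: "h 0 = 0" by (simp add: h_def)
  have gen: "generator (\<lambda>y. h y / c) x = - 1 / c" if x: "x \<in> {0..C} - {0}" for x c
  proof -
    have "generator (\<lambda>y. h y / c) x = (\<Sum>y\<in>{0..C}. engset_rate N C \<nu> \<mu> x y * (h y - h x)) / c"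
      unfolding generator_def by (simp add: sum_divide_distrib diff_divide_distrib[symmetric])
    then show ?thesis
      unfolding h_def using engset_hitting_mean_poisson_equation[OF pos, of x C N] x C by simp
  qed
  \<comment> \<open>The generator equals \<open>- 1 / h C\<close> exactly, and
    \<open>h x / h 1 \<ge> 1\<close> turns this constant into a multiple of the function;
    \<open>gen_le\<close> uses \<open>h x / h C \<le> 1\<close> in the same way.\<close>
  have gen_ge: "- (1 / h 1) * (h x / h C) \<le> generator (\<lambda>y. h y / h C) x" if x: "x \<in> {0..C} - {0}" for x
    unfolding gen[OF x] using h_ge[OF x] h1 hC by (simp add: field_simps)
  have gen_le: "generator (\<lambda>y. h y / h 1) x \<le> - (1 / h C) * (h x / h 1)" if x: "x \<in> {0..C} - {0}" for x
    unfolding gen[OF x] using h_le[OF x] h1 hC by (simp add: field_simps)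
  have Cin: "C \<in> {0..C} - {0}" using C by simp
  have "h C / h C * exp (- (1 / h 1) * t) \<le> prob {\<omega> \<in> space M. ereal t < hitting_time X 0 \<omega>}"
  proof (rule hitting_time_gt_ge[OF _ _ _ _ gen_ge assms(2) Cin t])
    fix x assume x: "x \<in> {0..C} - {0}"
    show "0 < h x / h C" "h x / h C \<le> 1" using h_ge[OF x] h_le[OF x] h1 hC by auto
  qed (use h0 in auto)
  then show "exp (- t / h 1) \<le> prob {\<omega> \<in> space M. ereal t < hitting_time X 0 \<omega>}"
    using hC by simp
  show "prob {\<omega> \<in> space M. ereal t < hitting_time X 0 \<omega>} \<le> h C / h 1 * exp (- t / h C)"
  \<comment> \<open>The grid argument for the upper bound requires \<open>t > 0\<close>; at 0 the
    right-hand side is at least 1.\<close>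
  proof (cases "t = 0")
    case True
    have "prob {\<omega> \<in> space M. ereal t < hitting_time X 0 \<omega>} \<le> 1" by simp
    also have "1 \<le> h C / h 1" using h1 h_ge[OF Cin] by simp
    finally show ?thesis using True by simp
  next
    case False
    have "prob {\<omega> \<in> space M. ereal t < hitting_time X 0 \<omega>} \<le> h C / h 1 * exp (- (1 / h C) * t)"
    proof (rule hitting_time_gt_le[OF _ _ _ gen_le assms(2) Cin])
      fix x assume x: "x \<in> {0..C} - {0}"
      show "1 \<le> h x / h 1" using h_ge[OF x] h1 by simp
    qed (use h0 t False in auto)
    then show ?thesis by simp
  qed
qed

section \<open>The de Moivre-Laplace theorem\<close>

lemma cdf_density_lborel_isCont:
  assumes "prob_space (density lborel f)" and f[measurable]: "f \<in> borel_measurable borel"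
  shows "isCont (cdf (density lborel f)) x"
proof -
  interpret real_distribution "density lborel f"
    using assms(1) by (auto simp: real_distribution_def real_distribution_axioms_def)
  have "AE y in lborel. y \<in> {x} \<longrightarrow> f y = 0"
    using AE_lborel_singleton[of x] by eventually_elim simp
  then have "{x} \<in> null_sets (density lborel f)"
    by (subst null_sets_density_iff) auto
  then have "measure (density lborel f) {x} = 0" by (simp add: null_sets_def measure_def)
  then show ?thesis by (simp add: isCont_cdf)
qed

text \<open>The law is invariant under \<open>x \<mapsto> - x\<close> and has no atom at 0, so both
  half-lines have equal mass.\<close>

lemma cdf_std_normal_0: "cdf std_normal_distribution 0 = 1 / 2"
proof -
  let ?N = "std_normal_distribution"
  interpret N: real_distribution ?N by (rule real_dist_normal_dist)
  have "distributed ?N lborel (\<lambda>x. x) std_normal_density"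
    by (auto simp: distributed_def distr_id2)
  from N.normal_density_affine[OF this, of "-1" 0]
  have "distributed ?N lborel (\<lambda>x. - x) std_normal_density" by simp
  then have "distr ?N lborel (\<lambda>x. - x) = ?N" by (simp add: distributed_def)
  then have "measure ?N {..0} = measure (distr ?N lborel (\<lambda>x. - x)) {..0}" by simp
  also have "\<dots> = measure ?N {0..}"
    by (subst measure_distr) (auto intro!: arg_cong[where f="measure ?N"])
  also have "{0..} = {0} \<union> (UNIV - {..0::real})" by auto
  also have "measure ?N ({0} \<union> (UNIV - {..0})) = measure ?N {0} + measure ?N (UNIV - {..0})"
    by (rule N.finite_measure_Union) auto
  also have "measure ?N {0} = 0"
    using cdf_density_lborel_isCont[OF prob_space_normal_density, of 1 0 0] N.isCont_cdf by simp
  also have "measure ?N (UNIV - {..0}) = 1 - measure ?N {..0}"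
    using N.prob_compl[of "{..0}"] by simp
  finally show ?thesis by (simp add: cdf_def)
qed

text \<open>The standardized capacity only tends to 0, so convergence is needed at a moving
  argument. Monotonicity compares \<open>c n\<close> with a fixed point on either side of
  \<open>c0\<close>, and continuity of the limit closes the gap.\<close>

lemma weak_conv_m_cdf_tendsto:
  assumes "weak_conv_m \<mu> M" and M: "\<And>n. real_distribution (\<mu> n)"
    and cont: "\<And>x. isCont (cdf M) x" and c: "c \<longlonglongrightarrow> c0"
  shows "(\<lambda>n. cdf (\<mu> n) (c n)) \<longlonglongrightarrow> cdf M c0"
proof -
  have lim: "(\<lambda>n. cdf (\<mu> n) x) \<longlonglongrightarrow> cdf M x" for x
    using assms(1) cont unfolding weak_conv_m_def weak_conv_def by blast
  have mono: "cdf (\<mu> n) x \<le> cdf (\<mu> n) y" if "x \<le> y" for n x y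
  proof -
    interpret real_distribution "\<mu> n" by (rule M)
    show ?thesis using that by (rule cdf_nondecreasing)
  qed
  show ?thesis
  proof (rule order_tendstoI)
    fix a assume a: "a < cdf M c0"
    have "\<forall>\<^sub>F x in at_left c0. a < cdf M x"
      using tendsto_mono[OF at_le[OF subset_UNIV] cont[of c0, unfolded isCont_def]] a
      by (rule order_tendstoD)
    then obtain x where x: "x < c0" "a < cdf M x"
      by (metis (no_types, lifting) dense eventually_at_left_field)
    have "\<forall>\<^sub>F n in sequentially. a < cdf (\<mu> n) x" using lim x(2) by (rule order_tendstoD)
    moreover have "\<forall>\<^sub>F n in sequentially. x < c n" using c x(1) by (rule order_tendstoD)
    ultimately show "\<forall>\<^sub>F n in sequentially. a < cdf (\<mu> n) (c n)"
    proof eventually_elim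
      case (elim n)
      then show ?case using mono[of x "c n" n] by simp
    qed
  next
    fix a assume a: "cdf M c0 < a"
    have "\<forall>\<^sub>F x in at_right c0. cdf M x < a"
      using tendsto_mono[OF at_le[OF subset_UNIV] cont[of c0, unfolded isCont_def]] a
      by (rule order_tendstoD)
    then obtain x where x: "c0 < x" "cdf M x < a"
      by (metis (no_types, lifting) dense eventually_at_right_field)
    have "\<forall>\<^sub>F n in sequentially. cdf (\<mu> n) x < a" using lim x(2) by (rule order_tendstoD)
    moreover have "\<forall>\<^sub>F n in sequentially. c n < x" using c x(1) by (rule order_tendstoD)
    ultimately show "\<forall>\<^sub>F n in sequentially. cdf (\<mu> n) (c n) < a"
    proof eventually_elim
      case (elim n)
      then show ?case using mono[of "c n" x n] by simp
    qed
  qed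
qed

lemma char_distr_binomial_pmf:
  assumes p: "p \<in> {0..1}"
  shows "char (distr (measure_pmf (binomial_pmf n p)) borel real) t =
    (of_real p * iexp t + of_real (1 - p)) ^ n"
proof -
  have "char (distr (measure_pmf (binomial_pmf n p)) borel real) t =
      (CLINT k|measure_pmf (binomial_pmf n p). iexp (t * real k))"
    unfolding char_def by (subst integral_distr) auto
  also have "\<dots> = (\<Sum>k\<le>n. pmf (binomial_pmf n p) k *\<^sub>R iexp (t * real k))"
    using p by (intro integral_measure_pmf) (auto simp: set_pmf_binomial_eq split: if_splits)
  also have "\<dots> = (\<Sum>k\<le>n. of_nat (n choose k) * (of_real p * iexp t) ^ k * of_real (1 - p) ^ (n - k))"
  proof (rule sum.cong[OF refl])
    fix k
    have "iexp (t * real k) = iexp t ^ k" by (simp add: exp_of_nat_mult[symmetric] mult_ac)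
    then show "pmf (binomial_pmf n p) k *\<^sub>R iexp (t * real k) =
        of_nat (n choose k) * (of_real p * iexp t) ^ k * of_real (1 - p) ^ (n - k)"
      using p by (simp add: scaleR_conv_of_real power_mult_distrib mult_ac)
  qed
  also have "\<dots> = (of_real p * iexp t + of_real (1 - p)) ^ n"
    by (rule binomial_ring[symmetric])
  finally show ?thesis .
qed

text \<open>Coordinates of an infinite product of Bernoulli laws supply the independent sequence for
  the central limit theorem. Their partial sums are recognized as binomial by characteristic
  functions.\<close>

lemma de_moivre_laplace:
  assumes p: "0 < p" "p < 1"
  shows "weak_conv_m
    (\<lambda>n. distr (measure_pmf (binomial_pmf n p)) borel (\<lambda>k. (real k - real n * p) / sqrt (real n * (p * (1 - p)))))
    std_normal_distribution"
proof -
  let ?B = "measure_pmf (bernoulli_pmf p)"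
  define P where "P = PiM (UNIV :: nat set) (\<lambda>_. ?B)"
  define Y :: "nat \<Rightarrow> (nat \<Rightarrow> bool) \<Rightarrow> real" where "Y = (\<lambda>i \<omega>. of_bool (\<omega> i))"
  interpret P: prob_space P unfolding P_def by (intro prob_space_PiM prob_space_measure_pmf)
  have coord: "(\<lambda>\<omega>. \<omega> i) \<in> P \<rightarrow>\<^sub>M ?B" for i unfolding P_def by simp
  have coord_distr: "distr P ?B (\<lambda>\<omega>. \<omega> i) = ?B" for i
    unfolding P_def by (rule distr_PiM_component) (auto simp: prob_space_measure_pmf)
  have "P.indep_vars (\<lambda>_. ?B) (\<lambda>i \<omega>. \<omega> i) UNIV"
  \<comment> \<open>For coordinate maps, the joint law and the product of the marginals are both the
    product measure itself.\<close>
  proof (subst P.indep_vars_iff_distr_eq_PiM'[OF _ coord])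
    show "distr P (\<Pi>\<^sub>M i\<in>UNIV. ?B) (\<lambda>x. \<lambda>i\<in>UNIV. x i) = (\<Pi>\<^sub>M i\<in>UNIV. distr P ?B (\<lambda>\<omega>. \<omega> i))"
      unfolding coord_distr unfolding P_def by (simp add: distr_id restrict_UNIV)
  qed simp
  then have indep: "P.indep_vars (\<lambda>_. borel) Y UNIV"
    unfolding Y_def by (rule P.indep_vars_compose2) simp
  have Y_rv[measurable]: "Y i \<in> borel_measurable P" for i
    using indep unfolding P.indep_vars_def2 by simp
  have Y_distr: "distr P borel (Y i) = distr ?B borel of_bool" for i
  proof -
    have "distr P borel (Y i) = distr (distr P ?B (\<lambda>\<omega>. \<omega> i)) borel of_bool"
      using coord[of i] by (subst distr_distr) (auto simp: Y_def comp_def)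
    then show ?thesis by (simp only: coord_distr)
  qed
  have Y_int: "P.expectation (\<lambda>\<omega>. g (Y i \<omega>)) = p * g 1 + (1 - p) * g 0"
    if g: "g \<in> borel_measurable borel" for g :: "real \<Rightarrow> real" and i
  proof -
    have "P.expectation (\<lambda>\<omega>. g (Y i \<omega>)) = (LINT y|distr P borel (Y i). g y)"
      using g by (subst integral_distr) auto
    also have "\<dots> = (LINT b|?B. g (of_bool b))"
      unfolding Y_distr using g by (subst integral_distr) auto
    also have "\<dots> = p * g 1 + (1 - p) * g 0" using p by simp
    finally show ?thesis .
  qed
  have mean: "P.expectation (Y i) = p" for i using Y_int[of "\<lambda>y. y" i] by simp
  have var: "P.variance (Y i) = (sqrt (p * (1 - p)))\<^sup>2" for i
  proof -
    have "P.variance (Y i) = p * (1 - p)\<^sup>2 + (1 - p) * (0 - p)\<^sup>2"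
      unfolding mean using Y_int[of "\<lambda>y. (y - p)\<^sup>2" i] by simp
    also have "\<dots> = p * (1 - p)" by (simp add: power2_eq_square algebra_simps)
    finally show ?thesis using p by simp
  qed
  have CLT: "weak_conv_m (\<lambda>n. distr P borel (\<lambda>\<omega>. (\<Sum>i<n. Y i \<omega> - p) / sqrt (real n * (sqrt (p * (1 - p)))\<^sup>2)))
      std_normal_distribution"
  proof (rule P.central_limit_theorem[OF indep mean])
    show "0 < sqrt (p * (1 - p))" using p by simp
    show "integrable P (\<lambda>\<omega>. (Y i \<omega>)\<^sup>2)" for i
    proof (rule P.integrable_const_bound[of _ 1])
      show "AE \<omega> in P. norm ((Y i \<omega>)\<^sup>2) \<le> 1" by (simp add: Y_def)
    qed measurable
    show "P.variance (Y i) = (sqrt (p * (1 - p)))\<^sup>2" for i by (rule var)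
    show "distr P borel (Y i) = distr ?B borel of_bool" for i by (rule Y_distr)
  qed
  have sum_distr: "distr P borel (\<lambda>\<omega>. \<Sum>i<n. Y i \<omega>) = distr (measure_pmf (binomial_pmf n p)) borel real" for n
  proof (rule Levy_uniqueness)
    have charY: "char (distr P borel (Y i)) t = of_real p * iexp t + of_real (1 - p)" for i t
    proof -
      have "char (distr P borel (Y i)) t = (CLINT b|?B. iexp (t * of_bool b))"
        unfolding Y_distr char_def by (subst integral_distr) auto
      also have "\<dots> = (\<Sum>b\<in>UNIV. pmf (bernoulli_pmf p) b *\<^sub>R iexp (t * of_bool b))"
        by (rule integral_measure_pmf) auto
      also have "\<dots> = of_real p * iexp t + of_real (1 - p)"
        using p by (simp add: UNIV_bool scaleR_conv_of_real)
      finally show ?thesis .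
    qed
    show "char (distr P borel (\<lambda>\<omega>. \<Sum>i<n. Y i \<omega>)) = char (distr (measure_pmf (binomial_pmf n p)) borel real)"
    proof
      fix t
      have "P.indep_vars (\<lambda>_. borel) Y {..<n}" by (rule P.indep_vars_subset[OF indep]) simp
      from P.char_distr_sum[OF this]
      have "char (distr P borel (\<lambda>\<omega>. \<Sum>i<n. Y i \<omega>)) t = (of_real p * iexp t + of_real (1 - p)) ^ n"
        by (simp only: charY prod_constant card_lessThan)
      then show "char (distr P borel (\<lambda>\<omega>. \<Sum>i<n. Y i \<omega>)) t =
          char (distr (measure_pmf (binomial_pmf n p)) borel real) t"
        using p by (subst char_distr_binomial_pmf) auto
    qed
    show "real_distribution (distr P borel (\<lambda>\<omega>. \<Sum>i<n. Y i \<omega>))"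
      by (rule P.real_distribution_distr) measurable
    show "real_distribution (distr (measure_pmf (binomial_pmf n p)) borel real)"
      by (rule prob_space.real_distribution_distr[OF prob_space_measure_pmf]) simp
  qed
  have "distr P borel (\<lambda>\<omega>. (\<Sum>i<n. Y i \<omega> - p) / sqrt (real n * (sqrt (p * (1 - p)))\<^sup>2)) =
    distr (measure_pmf (binomial_pmf n p)) borel (\<lambda>k. (real k - real n * p) / sqrt (real n * (p * (1 - p))))" for n
  proof -
    define g where "g = (\<lambda>s. (s - real n * p) / sqrt (real n * (p * (1 - p))))"
    have g[measurable]: "g \<in> borel_measurable borel" unfolding g_def by measurable
    have "distr P borel (g \<circ> (\<lambda>\<omega>. \<Sum>i<n. Y i \<omega>)) = distr (distr P borel (\<lambda>\<omega>. \<Sum>i<n. Y i \<omega>)) borel g"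
      by (rule distr_distr[symmetric]) measurable
    also have "\<dots> = distr (measure_pmf (binomial_pmf n p)) borel (g \<circ> real)"
      unfolding sum_distr by (rule distr_distr) simp_all
    finally have "distr P borel (g \<circ> (\<lambda>\<omega>. \<Sum>i<n. Y i \<omega>)) =
      distr (measure_pmf (binomial_pmf n p)) borel (g \<circ> real)" .
    moreover have "(sqrt (p * (1 - p)))\<^sup>2 = p * (1 - p)" using p by simp
    ultimately show ?thesis by (simp add: g_def comp_def sum_subtractf)
  qed
  then show ?thesis using CLT by simp
qed

text \<open>Standardizing maps \<open>C n\<close> to a threshold that tends to 0, because the
  deviation of \<open>C n\<close> from the mean is small against the standard deviation of order
  \<open>sqrt n\<close>.\<close>

lemma binomial_pmf_atMost_tendsto_half:
  assumes p: "0 < p" "p < 1" and C: "(\<lambda>n. real (C n) - p * real n) \<in> o(\<lambda>n. sqrt (real n))"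
  shows "(\<lambda>n. measure (measure_pmf (binomial_pmf n p)) {..C n}) \<longlonglongrightarrow> 1 / 2"
proof -
  let ?s = "\<lambda>n. sqrt (real n * (p * (1 - p)))"
  let ?c = "\<lambda>n. (real (C n) - real n * p) / ?s n"
  have "((\<lambda>n. (real (C n) - p * real n) / sqrt (real n)) \<longlongrightarrow> 0) sequentially"
    using C by (rule smalloD_tendsto)
  then have "(\<lambda>n. (real (C n) - p * real n) / sqrt (real n) * (1 / sqrt (p * (1 - p)))) \<longlonglongrightarrow> 0"
    by (rule tendsto_mult_left_zero)
  moreover have "(real (C n) - p * real n) / sqrt (real n) * (1 / sqrt (p * (1 - p))) = ?c n" for n
    by (simp add: real_sqrt_mult mult.commute)
  ultimately have c0: "?c \<longlonglongrightarrow> 0" by simp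
  have "(\<lambda>n. cdf (distr (measure_pmf (binomial_pmf n p)) borel (\<lambda>k. (real k - real n * p) / ?s n)) (?c n))
      \<longlonglongrightarrow> cdf std_normal_distribution 0"
  proof (rule weak_conv_m_cdf_tendsto[OF de_moivre_laplace[OF p] _ _ c0])
    show "real_distribution (distr (measure_pmf (binomial_pmf n p)) borel (\<lambda>k. (real k - real n * p) / ?s n))" for n
      by (rule prob_space.real_distribution_distr[OF prob_space_measure_pmf]) simp
    show "isCont (cdf std_normal_distribution) x" for x
      by (rule cdf_density_lborel_isCont) (auto intro: prob_space_normal_density)
  qed
  moreover have "\<forall>\<^sub>F n in sequentially.
      cdf (distr (measure_pmf (binomial_pmf n p)) borel (\<lambda>k. (real k - real n * p) / ?s n)) (?c n) =
      measure (measure_pmf (binomial_pmf n p)) {..C n}"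
    using eventually_gt_at_top[of 0]
  proof eventually_elim
    case (elim n)
    then have s: "0 < ?s n" using p by simp
    have "(\<lambda>k. (real k - real n * p) / ?s n) -` {..?c n} = {..C n}"
      using s by (auto simp: divide_le_cancel)
    then show ?case unfolding cdf_def by (subst measure_distr) auto
  qed
  ultimately show ?thesis unfolding cdf_std_normal_0 by (rule Lim_transform_eventually)
qed

section \<open>Asymptotics at the critical capacity\<close>

lemma engset_weight_pmf:
  assumes "0 < \<mu>" "0 < \<nu>" "\<mu> + \<nu> = 1" "j \<le> N"
  shows "\<mu> ^ N * engset_weight N \<nu> \<mu> j = pmf (binomial_pmf N \<nu>) j"
proof -
  have "\<mu> ^ N = \<mu> ^ (N - j) * \<mu> ^ j" using assms(4) by (simp flip: power_add)
  then have "\<mu> ^ N * engset_weight N \<nu> \<mu> j = real (N choose j) * \<nu> ^ j * \<mu> ^ (N - j)"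
    using assms(1) by (simp add: engset_weight_def power_divide)
  moreover have "\<mu> = 1 - \<nu>" using assms(3) by simp
  ultimately show ?thesis using assms(1,2) by simp
qed

lemma engset_weight_sum_pmf:
  assumes "0 < \<mu>" "0 < \<nu>" "\<mu> + \<nu> = 1" "C \<le> N"
  shows "\<mu> ^ N * (\<Sum>j=x..C. engset_weight N \<nu> \<mu> j) = measure (measure_pmf (binomial_pmf N \<nu>)) {x..C}"
  using assms by (simp add: measure_measure_pmf_finite sum_distrib_left engset_weight_pmf)

text \<open>The denominator at state 1 is \<open>N * (\<nu> / \<mu>) * \<mu>\<close>, that is
  \<open>N * \<nu>\<close>, and \<open>\<mu> ^ N\<close> normalizes the numerator.\<close>

lemma engset_descent_mean_1_scaled:
  assumes "0 < \<mu>" "0 < \<nu>" "\<mu> + \<nu> = 1" "1 \<le> N" "C \<le> N"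
  shows "real N * \<mu> ^ N * engset_descent_mean N C \<nu> \<mu> 1 =
    measure (measure_pmf (binomial_pmf N \<nu>)) {1..C} / \<nu>"
  using assms unfolding engset_weight_sum_pmf[OF assms(1,2,3,5), symmetric]
  by (simp add: engset_descent_mean_def engset_weight_def)

text \<open>Absorption extracts the factor \<open>N\<close> from the denominator and leaves a weight
  for \<open>N - 1\<close> sources; the normalized numerator is a probability.\<close>

lemma engset_descent_mean_Suc_scaled_le:
  assumes "0 < \<mu>" "0 < \<nu>" "\<mu> + \<nu> = 1" "Suc k \<le> C" "C \<le> N"
  shows "real N * \<mu> ^ N * engset_descent_mean N C \<nu> \<mu> (Suc k) \<le> 1 / (\<nu> * engset_weight (N - 1) \<nu> \<mu> k)"
proof -
  have pos: "0 < engset_weight (N - 1) \<nu> \<mu> k" using assms by (intro engset_weight_pos) auto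
  have N: "0 < real N" using assms by simp
  have "real (Suc k) * real (N choose Suc k) = real N * real (N - 1 choose k)"
    using binomial_absorption[of k N] by (metis of_nat_mult)
  moreover have "engset_weight N \<nu> \<mu> (Suc k) * (\<mu> * real (Suc k)) =
      \<nu> * (\<nu> / \<mu>) ^ k * (real (Suc k) * real (N choose Suc k))"
    using assms(1) by (simp add: engset_weight_def del: of_nat_Suc)
  ultimately have "engset_weight N \<nu> \<mu> (Suc k) * (\<mu> * real (Suc k)) =
      real N * (\<nu> * engset_weight (N - 1) \<nu> \<mu> k)"
    by (simp add: engset_weight_def del: of_nat_Suc)
  then have "real N * \<mu> ^ N * engset_descent_mean N C \<nu> \<mu> (Suc k) =
      \<mu> ^ N * (\<Sum>j=Suc k..C. engset_weight N \<nu> \<mu> j) / (\<nu> * engset_weight (N - 1) \<nu> \<mu> k)"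
    unfolding engset_descent_mean_def using N by simp
  also have "\<dots> \<le> 1 / (\<nu> * engset_weight (N - 1) \<nu> \<mu> k)"
    unfolding engset_weight_sum_pmf[OF assms(1,2,3,5)]
    using pos assms by (intro divide_right_mono) auto
  finally show ?thesis .
qed

text \<open>With \<open>b = n * (\<nu> / \<mu>)\<close> the weight is at least
  \<open>(b / (k + 1)) ^ (k + 1)\<close>. One factor is kept and yields the decay in
  \<open>n\<close>; the other \<open>k\<close> are each at least \<open>1 / z\<close> and yield the
  geometric decay.\<close>

lemma engset_weight_inverse_le:
  assumes "0 < \<mu>" "0 < \<nu>" "0 < z" "z < 1" "Suc k \<le> n" "real (Suc k) \<le> z * (real n * (\<nu> / \<mu>))"
  shows "1 / engset_weight n \<nu> \<mu> (Suc k) \<le> real (Suc k) * z ^ k / (real n * (\<nu> / \<mu>))"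
proof -
  let ?b = "real n * (\<nu> / \<mu>)"
  have b: "0 < ?b" using assms by simp
  have "real (Suc k) / z \<le> ?b"
    using assms(3,6) by (simp add: pos_divide_le_eq mult.commute)
  then have "1 / z \<le> ?b / real (Suc k)"
    by (subst pos_le_divide_eq) (simp_all del: of_nat_Suc)
  then have "?b / real (Suc k) * (1 / z) ^ k \<le> ?b / real (Suc k) * (?b / real (Suc k)) ^ k"
    using assms(1-3) by (intro mult_left_mono power_mono) auto
  also have "\<dots> = (real n / real (Suc k)) ^ Suc k * (\<nu> / \<mu>) ^ Suc k"
    by (simp add: power_mult_distrib power_divide field_simps del: of_nat_Suc)
  also have "\<dots> \<le> engset_weight n \<nu> \<mu> (Suc k)"
    unfolding engset_weight_def using assms
    by (intro mult_right_mono binomial_ge_n_over_k_pow_k) auto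
  finally have *: "?b / real (Suc k) * (1 / z) ^ k \<le> engset_weight n \<nu> \<mu> (Suc k)" .
  have "1 / engset_weight n \<nu> \<mu> (Suc k) \<le> 1 / (?b / real (Suc k) * (1 / z) ^ k)"
    by (rule divide_left_mono[OF *]) (use b assms engset_weight_pos in auto)
  also have "\<dots> = real (Suc k) * z ^ k / ?b"
    using assms(3) by (simp add: power_divide field_simps del: of_nat_Suc)
  finally show ?thesis .
qed

text \<open>The descents from levels 2 to \<open>C\<close> are dominated by the differentiated
  geometric series, whose sum does not depend on \<open>C\<close>; what remains is of order
  \<open>1 / N\<close>.\<close>

lemma engset_hitting_mean_diff_le:
  assumes "0 < \<mu>" "0 < \<nu>" "\<mu> + \<nu> = 1" "0 < z" "z < 1" "1 \<le> C" "C \<le> N"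
    and le: "real C \<le> z * (real (N - 1) * (\<nu> / \<mu>))"
  shows "real N * \<mu> ^ N * (engset_hitting_mean N C \<nu> \<mu> C - engset_hitting_mean N C \<nu> \<mu> 1) \<le>
    1 / (1 - z)\<^sup>2 / (\<nu> * (\<nu> / \<mu>)) / real (N - 1)"
proof -
  let ?D = "engset_descent_mean N C \<nu> \<mu>"
  obtain c where c: "C = Suc c" using assms by (cases C) auto
  have "engset_hitting_mean N C \<nu> \<mu> C = (\<Sum>k<Suc c. ?D (Suc k))"
    unfolding engset_hitting_mean_def using sum.atLeast1_atMost_eq[of ?D C] c by simp
  also have "\<dots> = engset_hitting_mean N C \<nu> \<mu> 1 + (\<Sum>k<c. ?D (Suc (Suc k)))"
    unfolding sum.lessThan_Suc_shift engset_hitting_mean_1 by simp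
  finally have "real N * \<mu> ^ N * (engset_hitting_mean N C \<nu> \<mu> C - engset_hitting_mean N C \<nu> \<mu> 1) =
      (\<Sum>k<c. real N * \<mu> ^ N * ?D (Suc (Suc k)))" by (simp add: sum_distrib_left)
  also have "\<dots> \<le> (\<Sum>k<c. real (Suc k) * z ^ k * (1 / (\<nu> * (\<nu> / \<mu>)) / real (N - 1)))"
  proof (rule sum_mono)
    fix k assume k: "k \<in> {..<c}"
    have "real N * \<mu> ^ N * ?D (Suc (Suc k)) \<le> 1 / \<nu> * (1 / engset_weight (N - 1) \<nu> \<mu> (Suc k))"
      using engset_descent_mean_Suc_scaled_le[OF assms(1,2,3), of "Suc k" C N] k c assms(7) by simp
    also have "\<dots> \<le> 1 / \<nu> * (real (Suc k) * z ^ k / (real (N - 1) * (\<nu> / \<mu>)))"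
      using assms k c le by (intro mult_left_mono engset_weight_inverse_le) auto
    finally show "real N * \<mu> ^ N * ?D (Suc (Suc k)) \<le>
        real (Suc k) * z ^ k * (1 / (\<nu> * (\<nu> / \<mu>)) / real (N - 1))"
      by (simp add: mult_ac)
  qed
  also have "\<dots> = (\<Sum>k<c. real (Suc k) * z ^ k) * (1 / (\<nu> * (\<nu> / \<mu>)) / real (N - 1))"
    by (rule sum_distrib_right[symmetric])
  also have "\<dots> \<le> 1 / (1 - z)\<^sup>2 * (1 / (\<nu> * (\<nu> / \<mu>)) / real (N - 1))"
  proof (rule mult_right_mono)
    have "(\<lambda>n. real (Suc n) * z ^ n) sums (1 / (1 - z)\<^sup>2)"
      using geometric_deriv_sums[of z] assms by simp
    then show "(\<Sum>k<c. real (Suc k) * z ^ k) \<le> 1 / (1 - z)\<^sup>2"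
      using assms by (metis (no_types, lifting) less_imp_le mult_nonneg_nonneg of_nat_0_le_iff sum_le_suminf finite_lessThan sums_iff zero_le_power)
  qed (use assms in simp)
  finally show ?thesis by simp
qed

section \<open>Limits of the scaled mean hitting times\<close>

context
  fixes \<mu> \<nu> :: real and C :: "nat \<Rightarrow> nat"
  assumes pos: "0 < \<mu>" "0 < \<nu>" and sum1: "\<mu> + \<nu> = 1"
    and C_bounds: "\<And>N. N \<ge> 1 \<Longrightarrow> 1 \<le> C N \<and> C N \<le> N"
    and C_critical: "(\<lambda>N. real (C N) - \<nu> * real N) \<in> o(\<lambda>N. sqrt (real N))"
begin

text \<open>Removing the atom at 0 from the event \<open>{..C N}\<close> costs
  \<open>\<mu> ^ N\<close>, which tends to 0.\<close>

lemma engset_hitting_mean_1_asymp: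
  "(\<lambda>N. real N * \<mu> ^ N * engset_hitting_mean N (C N) \<nu> \<mu> 1) \<longlonglongrightarrow> 1 / (2 * \<nu>)"
proof -
  have "(\<lambda>N. measure (measure_pmf (binomial_pmf N \<nu>)) {..C N}) \<longlonglongrightarrow> 1 / 2"
    using pos sum1 by (intro binomial_pmf_atMost_tendsto_half C_critical) auto
  moreover have "\<mu> < 1" using pos sum1 by linarith
  ultimately have "(\<lambda>N. (measure (measure_pmf (binomial_pmf N \<nu>)) {..C N} - \<mu> ^ N) / \<nu>) \<longlonglongrightarrow> (1 / 2 - 0) / \<nu>"
    using pos by (intro tendsto_intros LIMSEQ_power_zero) auto
  moreover have "\<forall>\<^sub>F N in sequentially. (measure (measure_pmf (binomial_pmf N \<nu>)) {..C N} - \<mu> ^ N) / \<nu> =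
      real N * \<mu> ^ N * engset_hitting_mean N (C N) \<nu> \<mu> 1"
    using eventually_ge_at_top[of 1]
  proof eventually_elim
    case (elim N)
    have "{..C N} = insert 0 {1..C N}" by auto
    then have "measure (measure_pmf (binomial_pmf N \<nu>)) {..C N} =
        pmf (binomial_pmf N \<nu>) 0 + measure (measure_pmf (binomial_pmf N \<nu>)) {1..C N}"
      by (simp add: measure_measure_pmf_finite)
    moreover have "pmf (binomial_pmf N \<nu>) 0 = \<mu> ^ N"
      using engset_weight_pmf[OF pos sum1, of 0 N] by (simp add: engset_weight_def)
    ultimately show ?case
      unfolding engset_hitting_mean_1
      using engset_descent_mean_1_scaled[OF pos sum1, of N "C N"] C_bounds[of N] elim by simp
  qed
  ultimately have "(\<lambda>N. real N * \<mu> ^ N * engset_hitting_mean N (C N) \<nu> \<mu> 1) \<longlonglongrightarrow> (1 / 2 - 0) / \<nu>"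
    by (rule Lim_transform_eventually)
  then show ?thesis by simp
qed

lemma capacity_ratio: "(\<lambda>N. real (C N) / real N) \<longlonglongrightarrow> \<nu>"
proof -
  have "(\<lambda>N. (real (C N) - \<nu> * real N) / sqrt (real N)) \<longlonglongrightarrow> 0"
    using C_critical by (rule smalloD_tendsto)
  moreover have "(\<lambda>N. 1 / sqrt (real N)) \<longlonglongrightarrow> 0" by real_asymp
  ultimately have "(\<lambda>N. (real (C N) - \<nu> * real N) / sqrt (real N) * (1 / sqrt (real N)) + \<nu>) \<longlonglongrightarrow> 0 * 0 + \<nu>"
    by (intro tendsto_intros)
  moreover have "\<forall>\<^sub>F N in sequentially.
      (real (C N) - \<nu> * real N) / sqrt (real N) * (1 / sqrt (real N)) + \<nu> = real (C N) / real N"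
    using eventually_gt_at_top[of 0]
  proof eventually_elim
    case (elim N)
    have "(real (C N) - \<nu> * real N) / sqrt (real N) * (1 / sqrt (real N)) = (real (C N) - \<nu> * real N) / real N"
      by simp
    then show ?case using elim by (simp add: field_simps)
  qed
  ultimately show ?thesis using Lim_transform_eventually by fastforce
qed

lemma engset_hitting_mean_asymp:
  "(\<lambda>N. real N * \<mu> ^ N * engset_hitting_mean N (C N) \<nu> \<mu> (C N)) \<longlonglongrightarrow> 1 / (2 * \<nu>)"
proof -
  \<comment> \<open>Since \<open>C N / N\<close> tends to \<nu>, the hypothesis of
    \<open>engset_hitting_mean_diff_le\<close> holds for large \<open>N\<close> once
    \<open>\<nu> < z * (\<nu> / \<mu>)\<close>. Any \<open>z\<close> strictly between \<mu> and 1
    works; this is the midpoint.\<close>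
  define z where "z = (1 + \<mu>) / 2"
  have z: "0 < z" "z < 1" "\<mu> < z" using pos sum1 by (auto simp: z_def)
  have "(\<lambda>N. z * (real (N - 1) / real N * (\<nu> / \<mu>))) \<longlonglongrightarrow> z * (1 * (\<nu> / \<mu>))"
    by (intro tendsto_intros) real_asymp
  from tendsto_diff[OF this capacity_ratio]
  have "\<forall>\<^sub>F N in sequentially. 0 < z * (real (N - 1) / real N * (\<nu> / \<mu>)) - real (C N) / real N"
    by (rule order_tendstoD) (use z pos in \<open>simp add: field_simps\<close>)
  then have upper: "\<forall>\<^sub>F N in sequentially.
      real N * \<mu> ^ N * (engset_hitting_mean N (C N) \<nu> \<mu> (C N) - engset_hitting_mean N (C N) \<nu> \<mu> 1)
      \<le> 1 / (1 - z)\<^sup>2 / (\<nu> * (\<nu> / \<mu>)) / real (N - 1)"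
    using eventually_ge_at_top[of 1]
  proof eventually_elim
    case (elim N)
    have "real (C N) / real N < z * (real (N - 1) * (\<nu> / \<mu>)) / real N"
      using elim(1) by (simp add: mult_ac)
    then have "real (C N) \<le> z * (real (N - 1) * (\<nu> / \<mu>))"
      using elim(2) by (simp only: divide_less_cancel) simp
    then show ?case
      using C_bounds[of N] elim by (intro engset_hitting_mean_diff_le pos sum1 z) auto
  qed
  have lower: "\<forall>\<^sub>F N in sequentially.
      0 \<le> real N * \<mu> ^ N * (engset_hitting_mean N (C N) \<nu> \<mu> (C N) - engset_hitting_mean N (C N) \<nu> \<mu> 1)"
    using eventually_ge_at_top[of 1]
  proof eventually_elim
    case (elim N)
    then show ?case
      using C_bounds[of N] engset_hitting_mean_mono[OF pos(2,1), of 1 "C N" "C N" N] pos by simp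
  qed
  have "(\<lambda>N. real N * \<mu> ^ N * (engset_hitting_mean N (C N) \<nu> \<mu> (C N) - engset_hitting_mean N (C N) \<nu> \<mu> 1)) \<longlonglongrightarrow> 0"
    by (rule tendsto_sandwich[OF lower upper tendsto_const]) real_asymp
  from tendsto_add[OF this engset_hitting_mean_1_asymp] show ?thesis by (simp add: algebra_simps)
qed

end

section \<open>From survival bounds to convergence in distribution\<close>

lemma engset_hitting_time_finite:
  assumes X: "engset_process M N C \<nu> \<mu> X" "AE \<omega> in M. X 0 \<omega> = C"
    and pos: "0 < \<nu>" "0 < \<mu>" and C: "1 \<le> C" "C \<le> N"
  shows "AE \<omega> in M. hitting_time X 0 \<omega> < \<infinity>"
proof -
  obtain p where "finite_markov_chain M {0..C} (engset_rate N C \<nu> \<mu>) X p"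
    using X(1) unfolding engset_process_def by (rule finite_markov_process_imp_chain)
  then interpret finite_markov_chain M "{0..C}" "engset_rate N C \<nu> \<mu>" X p .
  have [measurable]: "hitting_time X 0 \<in> borel_measurable M" by (rule hitting_time_measurable)
  let ?h = "engset_hitting_mean N C \<nu> \<mu>"
  have "0 < ?h 1" unfolding engset_hitting_mean_1 using pos C by (intro engset_descent_mean_pos) auto
  then have hC: "0 < ?h C" using engset_hitting_mean_mono[OF pos, of 1 C C N] C by simp
  have lim: "((\<lambda>t. ?h C / ?h 1 * exp (- t / ?h C)) \<longlongrightarrow> 0) at_top"
  proof -
    have "((\<lambda>t. exp (- (t / ?h C))) \<longlongrightarrow> 0) at_top"
      using hC by real_asymp
    from tendsto_mult_right_zero[OF this, of "?h C / ?h 1"] show ?thesis by simp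
  qed
  have "prob {\<omega> \<in> space M. hitting_time X 0 \<omega> = \<infinity>} \<le> 0"
  proof (rule tendsto_lowerbound[OF lim])
    show "\<forall>\<^sub>F t in at_top. prob {\<omega> \<in> space M. hitting_time X 0 \<omega> = \<infinity>} \<le> ?h C / ?h 1 * exp (- t / ?h C)"
      using eventually_ge_at_top[of 0]
    proof eventually_elim
      case (elim t)
      have "prob {\<omega> \<in> space M. hitting_time X 0 \<omega> = \<infinity>} \<le> prob {\<omega> \<in> space M. ereal t < hitting_time X 0 \<omega>}"
        by (rule finite_measure_mono) auto
      also have "\<dots> \<le> ?h C / ?h 1 * exp (- t / ?h C)"
        by (rule engset_hitting_time_bounds(2)[OF X pos C elim])
      finally show ?case .
    qed
  qed simp
  then have "prob {\<omega> \<in> space M. hitting_time X 0 \<omega> = \<infinity>} = 0"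
    using measure_nonneg[of M "{\<omega> \<in> space M. hitting_time X 0 \<omega> = \<infinity>}"] by linarith
  then have "AE \<omega> in M. hitting_time X 0 \<omega> \<noteq> \<infinity>"
    by (subst (asm) prob_Collect_eq_0) auto
  then show ?thesis by eventually_elim (simp add: less_top[symmetric] top_ereal_def)
qed

lemma engset_cdf_scaled_hitting_time:
  assumes X: "engset_process M N C \<nu> \<mu> X" "AE \<omega> in M. X 0 \<omega> = C"
    and pos: "0 < \<nu>" "0 < \<mu>" and C: "1 \<le> C" "C \<le> N" and c: "0 < c"
  shows "cdf (distr M borel (\<lambda>\<omega>. c * real_of_ereal (hitting_time X 0 \<omega>))) x =
    (if x < 0 then 0 else 1 - measure M {\<omega> \<in> space M. ereal (x / c) < hitting_time X 0 \<omega>})"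
proof -
  obtain p where "finite_markov_chain M {0..C} (engset_rate N C \<nu> \<mu>) X p"
    using X(1) unfolding engset_process_def by (rule finite_markov_process_imp_chain)
  then interpret finite_markov_chain M "{0..C}" "engset_rate N C \<nu> \<mu>" X p .
  have [measurable]: "hitting_time X 0 \<in> borel_measurable M" by (rule hitting_time_measurable)
  have "cdf (distr M borel (\<lambda>\<omega>. c * real_of_ereal (hitting_time X 0 \<omega>))) x =
      prob {\<omega> \<in> space M. c * real_of_ereal (hitting_time X 0 \<omega>) \<le> x}"
    unfolding cdf_def by (subst measure_distr) (auto intro!: arg_cong[where f=prob])
  also have "\<dots> = (if x < 0 then 0 else 1 - prob {\<omega> \<in> space M. ereal (x / c) < hitting_time X 0 \<omega>})"
  proof (cases "x < 0")
    case True
    have empty: "{\<omega> \<in> space M. c * real_of_ereal (hitting_time X 0 \<omega>) \<le> x} = {}"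
    proof -
      have "0 \<le> c * real_of_ereal (hitting_time X 0 \<omega>)" for \<omega>
        using c hitting_time_nonneg by (intro mult_nonneg_nonneg real_of_ereal_pos) auto
      then show ?thesis using True by (force dest: order_trans)
    qed
    show ?thesis unfolding empty using True by simp
  next
    case False
    have "prob {\<omega> \<in> space M. c * real_of_ereal (hitting_time X 0 \<omega>) \<le> x} =
        prob {\<omega> \<in> space M. \<not> ereal (x / c) < hitting_time X 0 \<omega>}"
    \<comment> \<open>The events agree only almost surely: \<open>real_of_ereal\<close> sends
      infinity to 0, so a path that never reaches 0 would belong to the first event but not to the
      second.\<close>
    proof (rule measure_eq_AE)
      show "AE \<omega> in M. (\<omega> \<in> {\<omega> \<in> space M. c * real_of_ereal (hitting_time X 0 \<omega>) \<le> x}) =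
          (\<omega> \<in> {\<omega> \<in> space M. \<not> ereal (x / c) < hitting_time X 0 \<omega>})"
        using engset_hitting_time_finite[OF X pos C]
      proof eventually_elim
        case (elim \<omega>)
        then obtain r where "hitting_time X 0 \<omega> = ereal r"
          using hitting_time_nonneg[of X 0 \<omega>] by (cases "hitting_time X 0 \<omega>") auto
        then show ?case using c by (simp add: not_less field_simps)
      qed
    qed measurable
    also have "\<dots> = 1 - prob {\<omega> \<in> space M. ereal (x / c) < hitting_time X 0 \<omega>}"
      by (rule prob_neg) measurable
    finally show ?thesis using False by simp
  qed
  finally show ?thesis .
qed

lemma cdf_exponential:
  assumes l: "0 < l"
  shows "cdf (density lborel (exponential_density l)) x = (if x < 0 then 0 else 1 - exp (- x * l))"
proof -
  interpret E: prob_space "density lborel (exponential_density l)"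
    by (rule prob_space_exponential_density[OF l])
  interpret E: real_distribution "density lborel (exponential_density l)"
    by standard simp
  have "distributed (density lborel (exponential_density l)) lborel (\<lambda>x. x) (exponential_density l)"
    using l by (auto simp: distributed_def distr_id2)
  from E.exponential_distributedD_le[OF this _ l]
  have nonneg: "cdf (density lborel (exponential_density l)) a = 1 - exp (- a * l)" if "0 \<le> a" for a
    using that by (simp add: cdf_def atMost_def)
  show ?thesis
  proof (cases "x < 0")
    \<comment> \<open>The distribution function is already 0 at 0, and it is monotone.\<close>
    case True
    then have "cdf (density lborel (exponential_density l)) x \<le> 0"
      using E.cdf_nondecreasing[of x 0] nonneg[of 0] by simp
    then show ?thesis using True E.cdf_nonneg[of x] by simp
  qed (use nonneg in simp)
qed

text \<open>The first conjunct gives the second its meaning: \<open>real_of_ereal\<close> sends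
  infinity to 0, so the real-valued law represents the hitting time only if that is almost surely
  finite.\<close>

theorem proposition11:
  fixes \<mu> \<nu> :: real
    and C :: "nat \<Rightarrow> nat"
    and M :: "nat \<Rightarrow> 'a measure"
    and X :: "nat \<Rightarrow> real \<Rightarrow> 'a \<Rightarrow> nat"
  assumes "\<mu> > 0" and "\<nu> > 0" and "\<mu> + \<nu> = 1"
    and "\<And>N. N \<ge> 1 \<Longrightarrow> 1 \<le> C N \<and> C N \<le> N"
    and "\<And>N. N \<ge> 1 \<Longrightarrow> engset_process (M N) N (C N) \<nu> \<mu> (X N)"
    and "\<And>N. N \<ge> 1 \<Longrightarrow> AE \<omega> in M N. X N 0 \<omega> = C N"
    and "(\<lambda>N. real (C N) - \<nu> * real N) \<in> o(\<lambda>N. sqrt (real N))"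
  shows "(\<forall>N\<ge>1. AE \<omega> in M N. hitting_time (X N) 0 \<omega> < \<infinity>) \<and>
    weak_conv_m
      (\<lambda>N. distr (M N) borel
        (\<lambda>\<omega>. real N * (1 - \<nu>) ^ N * real_of_ereal (hitting_time (X N) 0 \<omega>)))
      (density lborel (exponential_density (2 * \<nu>)))"
proof (intro conjI allI impI)
  fix N :: nat assume "1 \<le> N"
  then show "AE \<omega> in M N. hitting_time (X N) 0 \<omega> < \<infinity>"
    using assms(4)[of N] by (intro engset_hitting_time_finite[OF assms(5,6) assms(2,1)]) auto
next
  let ?F = "\<lambda>N. cdf (distr (M N) borel (\<lambda>\<omega>. real N * (1 - \<nu>) ^ N * real_of_ereal (hitting_time (X N) 0 \<omega>)))"
  let ?h = "\<lambda>N. engset_hitting_mean N (C N) \<nu> \<mu>"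
  let ?a = "\<lambda>N. real N * \<mu> ^ N"
  have \<mu>: "1 - \<nu> = \<mu>" using assms(3) by simp
  have F: "?F N x = (if x < 0 then 0 else 1 - measure (M N) {\<omega> \<in> space (M N). ereal (x / ?a N) < hitting_time (X N) 0 \<omega>})"
    if "1 \<le> N" for N x
    using assms(4)[OF that] that assms(1) unfolding \<mu>
    by (intro engset_cdf_scaled_hitting_time[OF assms(5,6)[OF that] assms(2,1)]) auto
  \<comment> \<open>The exponential law has no atoms, so convergence is shown at every real
    \<open>x\<close>.\<close>
  have "(\<lambda>N. ?F N x) \<longlonglongrightarrow> cdf (density lborel (exponential_density (2 * \<nu>))) x" for x
  proof (cases "x < 0")
    case True
    have "\<forall>\<^sub>F N in sequentially. cdf (density lborel (exponential_density (2 * \<nu>))) x = ?F N x"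
      using eventually_ge_at_top[of 1] by eventually_elim (use True F assms(2) in \<open>simp add: cdf_exponential\<close>)
    from Lim_transform_eventually[OF tendsto_const this] show ?thesis .
  next
    case False
    let ?P = "\<lambda>N. measure (M N) {\<omega> \<in> space (M N). ereal (x / ?a N) < hitting_time (X N) 0 \<omega>}"
    note asymp = engset_hitting_mean_1_asymp[OF assms(1,2,3,4,7)] engset_hitting_mean_asymp[OF assms(1,2,3,4,7)]
    have nz: "1 / (2 * \<nu>) \<noteq> 0" using assms(2) by simp
    have "(\<lambda>N. exp (- (x / (?a N * ?h N 1)))) \<longlonglongrightarrow> exp (- (x / (1 / (2 * \<nu>))))"
      by (intro tendsto_intros asymp nz)
    then have lower_lim: "(\<lambda>N. exp (- (x / (?a N * ?h N 1)))) \<longlonglongrightarrow> exp (- x * (2 * \<nu>))" by simp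
    have "(\<lambda>N. ?a N * ?h N (C N) / (?a N * ?h N 1) * exp (- (x / (?a N * ?h N (C N))))) \<longlonglongrightarrow>
        1 / (2 * \<nu>) / (1 / (2 * \<nu>)) * exp (- (x / (1 / (2 * \<nu>))))"
      by (intro tendsto_intros asymp nz)
    then have upper_lim: "(\<lambda>N. ?a N * ?h N (C N) / (?a N * ?h N 1) * exp (- (x / (?a N * ?h N (C N)))))
        \<longlonglongrightarrow> exp (- x * (2 * \<nu>))" using assms(2) by simp
    \<comment> \<open>The survival bounds are taken at time \<open>x / ?a N\<close>. Extending the
      prefactor by \<open>?a N\<close> writes everything in terms of the scaled means, which have a
      common nonzero limit.\<close>
    have bounds: "exp (- (x / (?a N * ?h N 1))) \<le> ?P N \<and>
        ?P N \<le> ?a N * ?h N (C N) / (?a N * ?h N 1) * exp (- (x / (?a N * ?h N (C N))))"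
      if N: "1 \<le> N" for N
    proof -
      have a: "0 < ?a N" using N assms(1) by simp
      then have "0 \<le> x / ?a N" using False by simp
      from engset_hitting_time_bounds[OF assms(5,6)[OF N] assms(2,1) _ _ this] assms(4)[OF N] a
      show ?thesis using assms(1) by simp
    qed
    have "?P \<longlonglongrightarrow> exp (- x * (2 * \<nu>))"
      by (rule tendsto_sandwich[OF _ _ lower_lim upper_lim])
        (use bounds in \<open>auto intro!: eventually_sequentiallyI[of 1]\<close>)
    then have "(\<lambda>N. 1 - ?P N) \<longlonglongrightarrow> 1 - exp (- x * (2 * \<nu>))" by (intro tendsto_intros)
    moreover have "\<forall>\<^sub>F N in sequentially. 1 - ?P N = ?F N x"
      using eventually_ge_at_top[of 1] by eventually_elim (use False F in simp)
    ultimately have "(\<lambda>N. ?F N x) \<longlonglongrightarrow> 1 - exp (- x * (2 * \<nu>))" by (rule Lim_transform_eventually)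
    then show ?thesis using False assms(2) by (simp add: cdf_exponential)
  qed
  then show "weak_conv_m
      (\<lambda>N. distr (M N) borel
        (\<lambda>\<omega>. real N * (1 - \<nu>) ^ N * real_of_ereal (hitting_time (X N) 0 \<omega>)))
      (density lborel (exponential_density (2 * \<nu>)))"
    unfolding weak_conv_m_def weak_conv_def by blast
qed

end
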